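(* Let $M_t$ be a family of smooth closed strictly convex surfaces in $\mathbb{R}^3$ moving according to $\frac{d}{dt}X=\frac HK\nu$. Then $$\max_{M_t}\frac{(\lambda_1-\lambda_2)^2}{4\lambda_1^2\lambda_2^2}$$ is non-increasing in time.
   Context: $X$ denotes the embedding, $\nu$ the outer unit normal, $\lambda_1,\lambda_2>0$ the principal curvatures, $H=\lambda_1+\lambda_2$, $K=\lambda_1\lambda_2$. *)

theory Defs
  imports "HOL-Analysis.Analysis"
begin

primrec dderiv :: "'a::real_normed_vector list \<Rightarrow> ('a \<Rightarrow> 'b::real_normed_vector) \<Rightarrow> 'a \<Rightarrow> 'b" where
  "dderiv [] f = f"
| "dderiv (v # vs) f = (\<lambda>x. frechet_derivative (dderiv vs f) (at x) v)"

definition smooth_on :: "'a::real_normed_vector set \<Rightarrow> ('a \<Rightarrow> 'b::real_normed_vector) \<Rightarrow> bool" where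
  "smooth_on U f \<longleftrightarrow> open U \<and> (\<forall>vs. dderiv vs f differentiable_on U)"

text \<open>The unit sphere, used as parameter domain of the closed surfaces.\<close>
abbreviation S2 :: "(real^3) set" where
  "S2 \<equiv> sphere 0 1"

definition gcirc :: "real^3 \<Rightarrow> real^3 \<Rightarrow> real \<Rightarrow> real^3" where
  "gcirc p u s = cos s *\<^sub>R p + sin s *\<^sub>R u"

definition unit_tangents :: "real^3 \<Rightarrow> (real^3) set" where
  "unit_tangents p = {u. norm u = 1 \<and> u \<bullet> p = 0}"

text \<open>Normal curvature of the surface F(S2) at F p in the tangent direction dF_p(u),
  with respect to the unit normal n: kappa = - <c'', n> / |c'|^2, c = F o gcirc p u.
  (Sign convention: the round sphere with its outer normal has curvature +1.)\<close>
definition normal_curv :: "(real^3 \<Rightarrow> real^3) \<Rightarrow> (real^3 \<Rightarrow> real^3) \<Rightarrow> real^3 \<Rightarrow> real^3 \<Rightarrow> real" where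
  "normal_curv F n p u =
     (let c = (\<lambda>s. F (gcirc p u s));
          c1 = vector_derivative c (at 0);
          c2 = vector_derivative (\<lambda>s. vector_derivative c (at s)) (at 0)
      in - (c2 \<bullet> n p) / (norm c1)\<^sup>2)"

text \<open>Principal curvatures: the extreme values of the normal curvature.\<close>
definition lam1 :: "(real^3 \<Rightarrow> real^3) \<Rightarrow> (real^3 \<Rightarrow> real^3) \<Rightarrow> real^3 \<Rightarrow> real" where
  "lam1 F n p = (SUP u\<in>unit_tangents p. normal_curv F n p u)"

definition lam2 :: "(real^3 \<Rightarrow> real^3) \<Rightarrow> (real^3 \<Rightarrow> real^3) \<Rightarrow> real^3 \<Rightarrow> real" where
  "lam2 F n p = (INF u\<in>unit_tangents p. normal_curv F n p u)"

definition embedded_sphere :: "(real^3 \<Rightarrow> real^3) \<Rightarrow> bool" where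
  "embedded_sphere F \<longleftrightarrow> inj_on F S2 \<and>
     (\<forall>p\<in>S2. \<forall>u. u \<bullet> p = 0 \<and> u \<noteq> 0 \<longrightarrow> frechet_derivative F (at p) u \<noteq> 0)"

definition outer_unit_normal :: "(real^3 \<Rightarrow> real^3) \<Rightarrow> (real^3 \<Rightarrow> real^3) \<Rightarrow> bool" where
  "outer_unit_normal F n \<longleftrightarrow> (\<forall>p\<in>S2. norm (n p) = 1 \<and>
     (\<forall>u. u \<bullet> p = 0 \<longrightarrow> frechet_derivative F (at p) u \<bullet> n p = 0) \<and>
     (\<forall>\<^sub>F s in at_right 0. F p + s *\<^sub>R n p \<in> outside (F ` S2)))"

end

theory Submission
  imports Defs
begin

text \<open>
  Parametrise the surfaces by their outer normal and extend the support function to a positively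
  1-homogeneous function H(t, z) of the space variable z.  The Hessian of H kills z, and its
  eigenvalues on the plane orthogonal to z, scaled by |z|, are the principal radii
  r1 = 1/lambda2 and r2 = 1/lambda1.  The speed of the flow is r1 + r2, so the flow becomes the
  linear equation dH/dt = |z|^2 Laplace(H), and the quantity to be controlled is (r1 - r2)^2/4.
  At a spatial maximum of r1 - r2, rotating the principal frame about each of the two principal
  directions and comparing second derivatives gives d/dt (r1 - r2) \<le> -2 (r1 - r2), so the maximum
  cannot increase.  This is a local argument: the inverse of the Gauss map is only needed near a
  maximum point, where the inverse function theorem provides it.
\<close>

subsection \<open>Continuously differentiable functions\<close>

text \<open>Two features of the hypotheses shape the argument. No regularity of \<open>nu\<close> is
  assumed, so a smooth normal direction has to be manufactured from derivatives of \<open>X\<close>,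
  and its sign relative to \<open>nu\<close> has to be recovered from strict convexity. Moreover the
  principal curvatures are extrema over directions, and r1 - r2 may fail to be differentiable at
  umbilics. Therefore continuity is read off from (r1 - r2)^2, a polynomial in the Hessian of H, and
  no eigenvalue is ever differentiated: for every orthonormal pair u, v orthogonal to z the quantity
  |z| (H_uu - H_vv) is at most r1 - r2, so the maximum can be tested on explicit frames that agree
  with the principal frame at the maximum point. At a positive maximum the bound -2 (r1 - r2) is
  strictly negative and contradicts maximality in time directly. Since H exists only on a small open
  set, its homogeneity enters solely through Euler's relation.\<close>

definition dd :: "'a::real_normed_vector \<Rightarrow> ('a \<Rightarrow> 'b::real_normed_vector) \<Rightarrow> 'a \<Rightarrow> 'b" where
  "dd v f x = frechet_derivative f (at x) v"

text \<open>Regularity is counted through derivatives in constant directions \<open>v\<close>, so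
  all levels concern functions with the same codomain and inductions avoid spaces of linear
  maps.\<close>

primrec Ck :: "nat \<Rightarrow> 'a::real_normed_vector set \<Rightarrow> ('a \<Rightarrow> 'b::real_normed_vector) \<Rightarrow> bool" where
  "Ck 0 S f \<longleftrightarrow> continuous_on S f"
| "Ck (Suc k) S f \<longleftrightarrow> f differentiable_on S \<and> (\<forall>v. Ck k S (dd v f))"

lemma dd_eqI: "(f has_derivative f') (at x) \<Longrightarrow> dd v f x = f' v"
  unfolding dd_def by (metis frechet_derivative_at)

lemma dd_has_derivative:
  assumes "open S" "Ck (Suc k) S f" "x \<in> S"
  shows "(f has_derivative (\<lambda>v. dd v f x)) (at x)"
proof -
  have "f differentiable (at x)"
    using assms by (auto simp: differentiable_on_def at_within_open[of _ S])
  then show ?thesis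
    unfolding dd_def by (simp add: frechet_derivative_works)
qed

lemma dd_cong:
  assumes "open S" "x \<in> S" "\<And>y. y \<in> S \<Longrightarrow> f y = g y"
  shows "dd v f x = dd v g x"
proof -
  have "(f has_derivative F) (at x) \<longleftrightarrow> (g has_derivative F) (at x)" for F
    using assms by (auto intro: has_derivative_transform_within_open[of _ _ _ UNIV S])
  then show ?thesis unfolding dd_def frechet_derivative_def by simp
qed

lemma Ck_cong:
  assumes "open S" "Ck k S f" "\<And>x. x \<in> S \<Longrightarrow> f x = g x"
  shows "Ck k S g"
  using assms(2,3)
proof (induction k arbitrary: f g)
  case 0
  then show ?case using continuous_on_eq by auto
next
  case (Suc k)
  have "g differentiable (at x within S)" if "x \<in> S" for x
    using Suc.prems(1) that has_derivative_transform[OF that, of g f] Suc.prems(2)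
    unfolding Ck.simps differentiable_on_def differentiable_def by metis
  then have "g differentiable_on S"
    unfolding differentiable_on_def by blast
  moreover have "Ck k S (dd v g)" for v
    by (rule Suc.IH[OF spec[OF conjunct2[OF Suc.prems(1)[unfolded Ck.simps]]] dd_cong[OF assms(1)]])
       (use Suc.prems(2) in auto)
  ultimately show ?case by simp
qed

lemma Ck_Suc:
  assumes "open S" "\<And>x. x \<in> S \<Longrightarrow> (f has_derivative f' x) (at x)"
    and "\<And>v. Ck k S (\<lambda>x. f' x v)"
  shows "Ck (Suc k) S f"
proof -
  have "f differentiable_on S"
    using assms(1,2) by (auto simp: differentiable_on_def at_within_open[of _ S] differentiable_def)
  moreover have "Ck k S (dd v f)" for v
    by (rule Ck_cong[OF assms(1) assms(3)[of v]]) (simp add: dd_eqI[OF assms(2)])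
  ultimately show ?thesis by simp
qed

lemma Ck_continuous: "Ck k S f \<Longrightarrow> continuous_on S f"
  by (cases k) (auto intro: differentiable_imp_continuous_on)

lemma Ck_dd: "Ck (Suc k) S f \<Longrightarrow> Ck k S (dd v f)"
  by simp

lemma Ck_pred: "Ck (Suc k) S f \<Longrightarrow> Ck k S f"
proof (induction k arbitrary: f)
  case 0
  then show ?case using differentiable_imp_continuous_on by auto
next
  case (Suc k)
  then show ?case by auto
qed

lemma Ck_subset: "Ck k S f \<Longrightarrow> T \<subseteq> S \<Longrightarrow> Ck k T f"
  by (induction k arbitrary: f) (auto intro: continuous_on_subset differentiable_on_subset)

lemma Ck_const: "open S \<Longrightarrow> Ck k S (\<lambda>_. c)"
proof (induction k arbitrary: c)
  case (Suc k)
  show ?case by (rule Ck_Suc[OF Suc.prems, of _ "\<lambda>_ _. 0"]) (use Suc in auto)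
qed auto

lemma Ck_linear:
  assumes "open S" "bounded_linear f"
  shows "Ck k S f"
proof (cases k)
  case 0
  then show ?thesis using assms by (simp add: linear_continuous_on)
next
  case (Suc j)
  show ?thesis unfolding Suc
    by (rule Ck_Suc[OF assms(1), of _ "\<lambda>_. f"])
       (use assms in \<open>auto intro: bounded_linear_imp_has_derivative Ck_const\<close>)
qed

lemma Ck_add:
  assumes "open S" "Ck k S f" "Ck k S g"
  shows "Ck k S (\<lambda>x. f x + g x)"
  using assms(2,3)
proof (induction k arbitrary: f g)
  case 0
  then show ?case by (auto intro: continuous_intros)
next
  case (Suc k)
  show ?case
  proof (rule Ck_Suc[OF assms(1)])
    fix x assume "x \<in> S"
    then show "((\<lambda>x. f x + g x) has_derivative (\<lambda>v. dd v f x + dd v g x)) (at x)"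
      by (intro has_derivative_add dd_has_derivative[OF assms(1) Suc.prems(1)] dd_has_derivative[OF assms(1) Suc.prems(2)])
  qed (use Suc in auto)
qed

lemma Ck_sum:
  assumes "open S" "\<And>i. i \<in> I \<Longrightarrow> Ck k S (f i)"
  shows "Ck k S (\<lambda>x. \<Sum>i\<in>I. f i x)"
  using assms(2)
  by (induction I rule: infinite_finite_induct) (auto intro: Ck_add Ck_const assms(1))

lemma Ck_bilinear:
  assumes "open S" "bounded_bilinear bop" "Ck k S f" "Ck k S g"
  shows "Ck k S (\<lambda>x. bop (f x) (g x))"
  using assms(3,4)
proof (induction k arbitrary: f g)
  case 0
  then show ?case using assms(2) by (auto intro: bounded_bilinear.continuous_on)
next
  case (Suc k)
  show ?case
  proof (rule Ck_Suc[OF assms(1)])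
    fix x assume "x \<in> S"
    then show "((\<lambda>x. bop (f x) (g x)) has_derivative (\<lambda>v. bop (f x) (dd v g x) + bop (dd v f x) (g x))) (at x)"
      by (intro bounded_bilinear.FDERIV[OF assms(2)] dd_has_derivative[OF assms(1) Suc.prems(1)] dd_has_derivative[OF assms(1) Suc.prems(2)])
  next
    fix v
    show "Ck k S (\<lambda>x. bop (f x) (dd v g x) + bop (dd v f x) (g x))"
      using Suc.prems Ck_pred[OF Suc.prems(1)] Ck_pred[OF Suc.prems(2)] by (intro Ck_add[OF assms(1)] Suc.IH) simp_all
  qed
qed

lemmas Ck_scaleR = Ck_bilinear[OF _ bounded_bilinear_scaleR]
lemmas Ck_mult = Ck_bilinear[OF _ bounded_bilinear_mult]
lemmas Ck_inner = Ck_bilinear[OF _ bounded_bilinear_inner]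

lemma Ck_linear_compose:
  assumes "open S" "bounded_linear h" "Ck k S f"
  shows "Ck k S (\<lambda>x. h (f x))"
  using assms(3)
proof (induction k arbitrary: f)
  case 0
  then show ?case using assms(2) by (auto intro: bounded_linear.continuous_on)
next
  case (Suc k)
  show ?case
    by (rule Ck_Suc[OF assms(1), of _ "\<lambda>x v. h (dd v f x)"])
       (use Suc in \<open>auto intro!: bounded_linear.has_derivative[OF assms(2)] dd_has_derivative[OF assms(1) Suc.prems]\<close>)
qed

lemma Ck_diff:
  assumes "open S" "Ck k S f" "Ck k S g"
  shows "Ck k S (\<lambda>x. f x - g x)"
  using Ck_add[OF assms(1,2) Ck_linear_compose[OF assms(1) bounded_linear_minus[OF bounded_linear_ident] assms(3)]]
  by simp

lemma Ck_Pair: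
  assumes "open S" "Ck k S f" "Ck k S g"
  shows "Ck k S (\<lambda>x. (f x, g x))"
proof -
  have "Ck k S (\<lambda>x. (f x, 0) + (0, g x))"
    by (intro Ck_add assms Ck_linear_compose[OF assms(1) _ assms(2), of "\<lambda>y. (y,0)"]
      Ck_linear_compose[OF assms(1) _ assms(3), of "\<lambda>y. (0,y)"])
      (auto intro: bounded_linear_intros)
  then show ?thesis by simp
qed

lemma dd_linear:
  assumes "open S" "Ck (Suc k) S f" "x \<in> S"
  shows "bounded_linear (\<lambda>v. dd v f x)"
  using dd_has_derivative[OF assms] has_derivative_bounded_linear by blast

lemma dd_expand:
  fixes f :: "'a::euclidean_space \<Rightarrow> 'b::real_normed_vector"
  assumes "open S" "Ck (Suc k) S f" "x \<in> S"
  shows "dd v f x = (\<Sum>b\<in>Basis. (v \<bullet> b) *\<^sub>R dd b f x)"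
proof -
  interpret bounded_linear "\<lambda>v. dd v f x" by (rule dd_linear[OF assms])
  have "dd v f x = dd (\<Sum>b\<in>Basis. (v \<bullet> b) *\<^sub>R b) f x"
    by (simp add: euclidean_representation)
  also have "\<dots> = (\<Sum>b\<in>Basis. (v \<bullet> b) *\<^sub>R dd b f x)"
    by (simp add: sum scaleR)
  finally show ?thesis .
qed

lemma dd_compose:
  assumes "open S" "open T" "Ck (Suc k) S f" "Ck (Suc k) T g" "x \<in> S" "f x \<in> T"
  shows "((\<lambda>x. g (f x)) has_derivative (\<lambda>v. dd (dd v f x) g (f x))) (at x)"
  using has_derivative_compose[OF dd_has_derivative[OF assms(1,3,5)] dd_has_derivative[OF assms(2,4,6)]]
  by simp

text \<open>The chain rule differentiates \<open>g\<close> in the moving direction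
  \<open>dd v f x\<close>. Expanding that direction in \<open>Basis\<close> gives a finite sum of
  products of functions that the induction hypothesis covers.\<close>

lemma Ck_compose:
  fixes f :: "'a::real_normed_vector \<Rightarrow> 'b::euclidean_space"
  assumes "open S" "open T" "f ` S \<subseteq> T" "Ck k S f" "Ck k T g"
  shows "Ck k S (\<lambda>x. g (f x))"
  using assms(4,5)
proof (induction k arbitrary: g)
  case 0
  then show ?case using assms(3) by (auto intro: continuous_on_compose2)
next
  case (Suc k)
  show ?case
  proof (rule Ck_Suc[OF assms(1)])
    fix x assume x: "x \<in> S"
    then have fx: "f x \<in> T" using assms(3) by auto
    show "((\<lambda>x. g (f x)) has_derivative (\<lambda>v. (\<Sum>b\<in>Basis. (dd v f x \<bullet> b) *\<^sub>R dd b g (f x)))) (at x)"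
      using dd_compose[OF assms(1,2) Suc.prems x fx]
      by (subst (asm) dd_expand[OF assms(2) Suc.prems(2) fx])
  next
    fix v
    show "Ck k S (\<lambda>x. \<Sum>b\<in>Basis. (dd v f x \<bullet> b) *\<^sub>R dd b g (f x))"
      using Suc.IH Suc.prems Ck_pred[OF Suc.prems(1)]
      by (intro Ck_sum Ck_scaleR Ck_inner Ck_const assms(1)) auto
  qed
qed

text \<open>The derivative of 1/|x| is a product of copies of 1/|x| and a linear function, so the
  induction closes up.\<close>

lemma Ck_inverse_norm:
  fixes S :: "'a::real_inner set"
  assumes "open S" "0 \<notin> S"
  shows "Ck k S (\<lambda>x. inverse (norm x))"
proof (induction k)
  case 0
  then show ?case using assms(2) by (auto intro!: continuous_intros)
next
  case (Suc k)
  let ?r = "\<lambda>x::'a. inverse (norm x)"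
  show ?case
  proof (rule Ck_Suc[OF assms(1)])
    fix x assume "x \<in> S"
    then have "x \<noteq> 0" using assms(2) by auto
    then show "(?r has_derivative (\<lambda>v. - (?r x * ?r x * ?r x * (x \<bullet> v)))) (at x)"
      by (auto intro!: derivative_eq_intros has_derivative_norm simp: sgn_div_norm inner_commute field_simps)
  next
    fix v
    have "Ck k S (\<lambda>x. (-1) * (?r x * ?r x * ?r x * (x \<bullet> v)))"
      by (intro Ck_mult Ck_inner Ck_const Ck_linear[of _ "\<lambda>x. x"] Suc.IH assms(1)) (auto intro: bounded_linear_ident)
    then show "Ck k S (\<lambda>x. - (?r x * ?r x * ?r x * (x \<bullet> v)))" by simp
  qed
qed

lemma smooth_on_Ck:
  assumes "smooth_on S f"
  shows "Ck k S f"
proof -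
  \<comment> \<open>\<open>dderiv\<close> adds new directions on the outside, whereas
    \<open>Ck\<close> peels off the innermost derivative; appending at the end of the list mediates
    between the two.\<close>
  have *: "dderiv (vs @ [v]) f = dderiv vs (dd v f)" for vs v and f :: "'a \<Rightarrow> 'b"
  proof -
    have "dd v f = (\<lambda>x. frechet_derivative f (at x) v)" by (simp add: dd_def fun_eq_iff)
    then show ?thesis by (induction vs) simp_all
  qed
  have "\<forall>vs. dderiv vs f differentiable_on S \<Longrightarrow> Ck k S f" for f :: "'a \<Rightarrow> 'b"
  proof (induction k arbitrary: f)
    case 0
    from 0[rule_format, of "[]"] show ?case by (simp add: differentiable_imp_continuous_on)
  next
    case (Suc k)
    have "f differentiable_on S" using Suc.prems[rule_format, of "[]"] by simp
    moreover have "Ck k S (dd v f)" for v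
      using Suc.prems[rule_format, of "_ @ [v]"] unfolding * by (intro Suc.IH) blast
    ultimately show ?case by simp
  qed
  then show ?thesis using assms unfolding smooth_on_def by blast
qed

subsection \<open>Symmetry of second derivatives and smooth inverses\<close>

lemma dd_line:
  assumes "open S" "Ck (Suc k) S f" "x + s *\<^sub>R v \<in> S"
  shows "((\<lambda>s. f (x + s *\<^sub>R v)) has_vector_derivative dd v f (x + s *\<^sub>R v)) (at s)"
proof -
  interpret bounded_linear "\<lambda>w. dd w f (x + s *\<^sub>R v)" by (rule dd_linear[OF assms])
  have "((\<lambda>s. x + s *\<^sub>R v) has_derivative (\<lambda>h. h *\<^sub>R v)) (at s)"
    by (auto intro!: derivative_eq_intros)
  from has_derivative_compose[OF this dd_has_derivative[OF assms]] show ?thesis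
    unfolding has_vector_derivative_def by (simp add: scaleR)
qed

lemma dd_line_real:
  fixes f :: "'a::real_normed_vector \<Rightarrow> real"
  assumes "open S" "Ck (Suc k) S f" "x + s *\<^sub>R v \<in> S"
  shows "((\<lambda>s. f (x + s *\<^sub>R v)) has_real_derivative dd v f (x + s *\<^sub>R v)) (at s)"
  using dd_line[OF assms] by (simp add: has_real_derivative_iff_has_vector_derivative)

lemma dd_linear_compose:
  assumes "open S" "Ck (Suc k) S f" "x \<in> S" "bounded_linear h"
  shows "dd v (\<lambda>x. h (f x)) x = h (dd v f x)"
  by (rule dd_eqI[OF bounded_linear.has_derivative[OF assms(4) dd_has_derivative[OF assms(1-3)]]])

lemma dd_bilinear:
  assumes "open S" "bounded_bilinear bop" "Ck (Suc k) S f" "Ck (Suc k) S g" "x \<in> S"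
  shows "dd v (\<lambda>x. bop (f x) (g x)) x = bop (f x) (dd v g x) + bop (dd v f x) (g x)"
  by (rule dd_eqI[OF bounded_bilinear.FDERIV[OF assms(2) dd_has_derivative[OF assms(1,3,5)]
      dd_has_derivative[OF assms(1,4,5)]]])

lemmas dd_inner = dd_bilinear[OF _ bounded_bilinear_inner]
lemmas dd_mult = dd_bilinear[OF _ bounded_bilinear_mult]

lemma dd_add:
  assumes "open S" "Ck (Suc k) S f" "Ck (Suc k) S g" "x \<in> S"
  shows "dd v (\<lambda>x. f x + g x) x = dd v f x + dd v g x"
  by (rule dd_eqI[OF has_derivative_add[OF dd_has_derivative[OF assms(1,2,4)] dd_has_derivative[OF assms(1,3,4)]]])

text \<open>The mean value theorem, applied along \<open>u\<close> and then along \<open>w\<close>,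
  turns the second difference into h^2 times the mixed derivative at a nearby point. The second
  difference is symmetric in \<open>u\<close> and \<open>w\<close>, which is why second derivatives
  commute.\<close>

lemma second_difference_tendsto:
  fixes f :: "'a::real_normed_vector \<Rightarrow> real"
  assumes S: "open S" and f: "Ck (Suc (Suc k)) S f" and x: "x \<in> S"
  shows "((\<lambda>h. (f (x + h *\<^sub>R u + h *\<^sub>R w) - f (x + h *\<^sub>R u) - f (x + h *\<^sub>R w) + f x) / h\<^sup>2)
           \<longlongrightarrow> dd w (dd u f) x) (at_right 0)"
proof (rule tendstoI)
  fix e :: real assume e: "e > 0"
  let ?F = "dd w (dd u f)"
  have fu: "Ck (Suc k) S (dd u f)" using f by simp
  have "continuous_on S ?F" using fu by (intro Ck_continuous[of k]) simp
  then have "isCont ?F x" using S x continuous_on_eq_continuous_at by blast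
  then obtain d1 where d1: "d1 > 0" "\<And>y. dist y x < d1 \<Longrightarrow> dist (?F y) (?F x) < e"
    using e unfolding continuous_at_eps_delta by blast
  obtain d2 where d2: "d2 > 0" "ball x d2 \<subseteq> S" using S x open_contains_ball by blast
  \<comment> \<open>For \<open>h < d\<close> the whole parallelogram spanned by
    \<open>h *\<^sub>R u\<close> and \<open>h *\<^sub>R w\<close> lies in both balls; the summand 1
    keeps the denominator positive when both directions are zero.\<close>
  define d where "d = min d1 d2 / (norm u + norm w + 1)"
  have n1: "norm u + norm w + 1 > 0" by (smt (verit) norm_ge_zero)
  have d: "d > 0" unfolding d_def using d1(1) d2(1) n1 by simp
  have near: "dist (x + s *\<^sub>R u + t *\<^sub>R w) x < min d1 d2" if "0 \<le> s" "s \<le> h" "0 \<le> t" "t \<le> h" "0 < h" "h < d" for s t h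
  proof -
    have "dist (x + s *\<^sub>R u + t *\<^sub>R w) x = norm (s *\<^sub>R u + t *\<^sub>R w)"
      by (simp add: dist_norm)
    also have "\<dots> \<le> s * norm u + t * norm w"
      using norm_triangle_ineq[of "s *\<^sub>R u" "t *\<^sub>R w"] that by simp
    also have "\<dots> \<le> h * norm u + h * norm w"
      using that by (intro add_mono mult_right_mono) auto
    also have "\<dots> < h * (norm u + norm w + 1)" using that by (simp add: algebra_simps)
    also have "\<dots> < d * (norm u + norm w + 1)" using that n1 by (intro mult_strict_right_mono) auto
    also have "\<dots> = min d1 d2" unfolding d_def using n1 by simp
    finally show ?thesis .
  qed
  then have inS: "x + s *\<^sub>R u + t *\<^sub>R w \<in> S" if "0 \<le> s" "s \<le> h" "0 \<le> t" "t \<le> h" "0 < h" "h < d" for s t h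
    using that d2(2) by (auto simp: dist_commute)
  have "dist ((f (x + h *\<^sub>R u + h *\<^sub>R w) - f (x + h *\<^sub>R u) - f (x + h *\<^sub>R w) + f x) / h\<^sup>2) (?F x) < e"
    if h: "0 < h" "h < d" for h
  proof -
    have "\<exists>s. 0 < s \<and> s < h \<and> (f (x + h *\<^sub>R u + h *\<^sub>R w) - f (x + h *\<^sub>R u)) - (f (x + 0 *\<^sub>R u + h *\<^sub>R w) - f (x + 0 *\<^sub>R u))
        = (h - 0) * (dd u f (x + s *\<^sub>R u + h *\<^sub>R w) - dd u f (x + s *\<^sub>R u))"
    proof (rule MVT2[OF h(1)])
      fix s assume s: "0 \<le> s" "s \<le> h"
      have 1: "(x + h *\<^sub>R w) + s *\<^sub>R u \<in> S" using inS[of s h h] s h by (simp add: algebra_simps)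
      have 2: "x + s *\<^sub>R u \<in> S" using inS[of s h 0] s h by simp
      show "((\<lambda>s. f (x + s *\<^sub>R u + h *\<^sub>R w) - f (x + s *\<^sub>R u)) has_real_derivative
         dd u f (x + s *\<^sub>R u + h *\<^sub>R w) - dd u f (x + s *\<^sub>R u)) (at s)"
        using DERIV_diff[OF dd_line_real[OF S f 1] dd_line_real[OF S f 2]]
        by (simp add: algebra_simps)
    qed
    then obtain s where s: "0 < s" "s < h" and eq1: "f (x + h *\<^sub>R u + h *\<^sub>R w) - f (x + h *\<^sub>R u) - f (x + h *\<^sub>R w) + f x
        = h * (dd u f (x + s *\<^sub>R u + h *\<^sub>R w) - dd u f (x + s *\<^sub>R u))" by (auto simp: algebra_simps)
    have "\<exists>t. 0 < t \<and> t < h \<and> dd u f (x + s *\<^sub>R u + h *\<^sub>R w) - dd u f (x + s *\<^sub>R u + 0 *\<^sub>R w)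
        = (h - 0) * ?F (x + s *\<^sub>R u + t *\<^sub>R w)"
      by (rule MVT2[OF h(1)]) (use inS[of s h] s h in \<open>auto intro!: dd_line_real[OF S fu]\<close>)
    then obtain t where t: "0 < t" "t < h" and eq2: "dd u f (x + s *\<^sub>R u + h *\<^sub>R w) - dd u f (x + s *\<^sub>R u)
        = h * ?F (x + s *\<^sub>R u + t *\<^sub>R w)" by auto
    have "(f (x + h *\<^sub>R u + h *\<^sub>R w) - f (x + h *\<^sub>R u) - f (x + h *\<^sub>R w) + f x) / h\<^sup>2 = ?F (x + s *\<^sub>R u + t *\<^sub>R w)"
      unfolding eq1 eq2 using h by (simp add: power2_eq_square)
    then show ?thesis using d1(2) near[of s h t] s t h by simp
  qed
  then show "\<forall>\<^sub>F h in at_right 0. dist ((f (x + h *\<^sub>R u + h *\<^sub>R w) - f (x + h *\<^sub>R u) - f (x + h *\<^sub>R w) + f x) / h\<^sup>2) (?F x) < e"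
    unfolding eventually_at_right_field using d by blast
qed

lemma dd_commute_real:
  fixes f :: "'a::real_normed_vector \<Rightarrow> real"
  assumes S: "open S" and f: "Ck (Suc (Suc k)) S f" and x: "x \<in> S"
  shows "dd u (dd w f) x = dd w (dd u f) x"
proof (rule tendsto_unique[OF _ second_difference_tendsto[OF assms] ])
  have "x + h *\<^sub>R w + h *\<^sub>R u = x + h *\<^sub>R u + h *\<^sub>R w" for h by simp
  with second_difference_tendsto[OF assms, of u w]
  show "((\<lambda>h. (f (x + h *\<^sub>R w + h *\<^sub>R u) - f (x + h *\<^sub>R w) - f (x + h *\<^sub>R u) + f x) / h\<^sup>2)
           \<longlongrightarrow> dd w (dd u f) x) (at_right 0)"
    by (simp add: algebra_simps)
qed simp

lemma dd_commute:
  fixes f :: "'a::real_normed_vector \<Rightarrow> 'b::euclidean_space"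
  assumes S: "open S" and f: "Ck (Suc (Suc k)) S f" and x: "x \<in> S"
  shows "dd u (dd w f) x = dd w (dd u f) x"
proof (rule euclidean_eqI)
  fix b :: 'b assume "b \<in> Basis"
  have *: "dd u (dd w f) x \<bullet> b = dd u (dd w (\<lambda>x. f x \<bullet> b)) x" for u w
  proof -
    have "dd u (dd w f) x \<bullet> b = dd u (\<lambda>x. dd w f x \<bullet> b) x"
      using f by (intro dd_linear_compose[OF S _ x bounded_linear_inner_left, symmetric, of k]) simp
    also have "\<dots> = dd u (dd w (\<lambda>x. f x \<bullet> b)) x"
      by (intro dd_cong[OF S x] dd_linear_compose[OF S f _ bounded_linear_inner_left, symmetric])
    finally show ?thesis .
  qed
  show "dd u (dd w f) x \<bullet> b = dd w (dd u f) x \<bullet> b"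
    unfolding * by (rule dd_commute_real[OF S _ x])
      (rule Ck_linear_compose[OF S bounded_linear_inner_left f])
qed

text \<open>Where the differentiable factor vanishes, continuity of the other factor suffices,
  because the remainder \<open>(c y - c x) *\<^sub>R f' (y - x)\<close> is of lower order. This
  differentiates the solution of a linear system before it is known to be differentiable.\<close>

lemma has_derivative_scaleR_vanishing:
  fixes c :: "'a::real_normed_vector \<Rightarrow> real"
  assumes f: "(f has_derivative f') (at x)" and "f x = 0" and c: "isCont c x"
  shows "((\<lambda>y. c y *\<^sub>R f y) has_derivative (\<lambda>h. c x *\<^sub>R f' h)) (at x)"
proof -
  interpret f': bounded_linear f' using f by (rule has_derivative_bounded_linear)
  obtain K where K: "\<And>h. norm (f' h) \<le> norm h * K" using f'.bounded by blast
  have lim: "((\<lambda>y. norm (f y - f x - f' (y - x)) / norm (y - x)) \<longlongrightarrow> 0) (at x)"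
    using f unfolding has_derivative_iff_norm by simp
  have c0: "((\<lambda>y. c y - c x) \<longlongrightarrow> 0) (at x)"
    using c unfolding isCont_def by (rule LIM_zero)
  have bnd: "norm (norm (c y *\<^sub>R f y - c x *\<^sub>R f x - c x *\<^sub>R f' (y - x)) / norm (y - x))
      \<le> \<bar>c y\<bar> * (norm (f y - f x - f' (y - x)) / norm (y - x)) + \<bar>c y - c x\<bar> * K" if "y \<noteq> x" for y
  proof -
    have "c y *\<^sub>R f y - c x *\<^sub>R f x - c x *\<^sub>R f' (y - x)
        = c y *\<^sub>R (f y - f x - f' (y - x)) + (c y - c x) *\<^sub>R f' (y - x)"
      using assms(2) by (simp add: algebra_simps)
    also have "norm \<dots> \<le> \<bar>c y\<bar> * norm (f y - f x - f' (y - x)) + \<bar>c y - c x\<bar> * (norm (y - x) * K)"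
      using K by (intro norm_triangle_le add_mono) (auto intro: mult_left_mono)
    finally show ?thesis using that by (simp add: field_simps)
  qed
  have "((\<lambda>y. \<bar>c y\<bar> * (norm (f y - f x - f' (y - x)) / norm (y - x)) + \<bar>c y - c x\<bar> * K) \<longlongrightarrow> \<bar>c x\<bar> * 0 + \<bar>0\<bar> * K) (at x)"
    by (intro tendsto_intros lim c0 c[unfolded isCont_def])
  then have "((\<lambda>y. norm (c y *\<^sub>R f y - c x *\<^sub>R f x - c x *\<^sub>R f' (y - x)) / norm (y - x)) \<longlongrightarrow> 0) (at x)"
    by (intro Lim_null_comparison[OF eventually_mono[OF eventually_neq_at_within bnd]]) simp_all
  then show ?thesis
    unfolding has_derivative_iff_norm
    by (auto intro!: bounded_linear_scaleR_right bounded_linear_compose[OF bounded_linear_scaleR_right f'.bounded_linear_axioms])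
qed

text \<open>Freezing the matrix at \<open>y0\<close> leaves error terms in which the unknown
  \<open>w y\<close> only multiplies coefficient differences that vanish at
  \<open>y0\<close>.\<close>

lemma linear_solve_expand:
  fixes M :: "'a \<Rightarrow> 'b::euclidean_space \<Rightarrow> 'b"
  assumes "linear (M y)" "linear (M y0)" "M y (w y) = v y" "M y0 (w y0) = v y0"
  shows "M y0 (w y - w y0) = v y - v y0 - (\<Sum>b\<in>Basis. (w y \<bullet> b) *\<^sub>R (M y b - M y0 b))"
proof -
  have *: "M z (w y) = (\<Sum>b\<in>Basis. (w y \<bullet> b) *\<^sub>R M z b)" if "linear (M z)" for z
    by (subst euclidean_representation[of "w y", symmetric])
      (simp only: linear_sum[OF that] linear_cmul[OF that])
  have "v y = (\<Sum>b\<in>Basis. (w y \<bullet> b) *\<^sub>R M y b)"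
    using *[OF assms(1)] assms(3) by simp
  then show ?thesis
    using *[OF assms(2)] assms(4)
    by (simp add: linear_diff[OF assms(2)] scaleR_diff_right sum_subtractf)
qed

lemma linear_solve_isCont:
  fixes M :: "'a::real_normed_vector \<Rightarrow> 'b::euclidean_space \<Rightarrow> 'b"
  assumes T: "open T" "y0 \<in> T"
    and lin: "\<And>y. y \<in> T \<Longrightarrow> linear (M y)" and inj: "inj (M y0)"
    and eq: "\<And>y. y \<in> T \<Longrightarrow> M y (w y) = v y"
    and M: "\<And>b. isCont (\<lambda>y. M y b) y0" and v: "isCont v y0"
  shows "isCont w y0"
proof -
  obtain c where c: "c > 0" "\<And>x. c * norm x \<le> norm (M y0 x)"
    using linear_inj_bounded_below_pos[OF lin[OF T(2)] inj] by metis
  define E where "E y = (\<Sum>b\<in>Basis. norm (M y b - M y0 b))" for y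
  have E0: "(E \<longlongrightarrow> 0) (at y0)"
  proof -
    have "(E \<longlongrightarrow> (\<Sum>b\<in>(Basis::'b set). norm (M y0 b - M y0 b))) (at y0)"
      unfolding E_def using M unfolding isCont_def by (intro tendsto_intros)
    then show ?thesis by simp
  qed
  have Epos: "E y \<ge> 0" for y unfolding E_def by (simp add: sum_nonneg)
  have v0: "((\<lambda>y. norm (v y - v y0)) \<longlongrightarrow> 0) (at y0)"
    using v unfolding isCont_def by (simp add: LIM_zero tendsto_norm_zero)
  \<comment> \<open>The factor 2 / c arises by absorbing the term
    \<open>norm (w y - w y0) * E y\<close> into the left side, possible once
    \<open>E y < c / 2\<close>.\<close>
  have "\<forall>\<^sub>F y in at y0. norm (w y - w y0) \<le> (2 / c) * (norm (v y - v y0) + norm (w y0) * E y)"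
  proof -
    have "\<forall>\<^sub>F y in at y0. y \<in> T" using T eventually_at_topological by blast
    moreover have "\<forall>\<^sub>F y in at y0. E y < c / 2" by (rule order_tendstoD(2)[OF E0]) (use c in simp)
    ultimately show ?thesis
    proof eventually_elim
      case (elim y)
      have "c * norm (w y - w y0) \<le> norm (M y0 (w y - w y0))" by (rule c)
      also have "\<dots> \<le> norm (v y - v y0) + norm (\<Sum>b\<in>Basis. (w y \<bullet> b) *\<^sub>R (M y b - M y0 b))"
        by (subst linear_solve_expand[of M y y0 w v]) (use lin eq T elim in \<open>auto intro: norm_triangle_ineq4\<close>)
      also have "norm (\<Sum>b\<in>Basis. (w y \<bullet> b) *\<^sub>R (M y b - M y0 b)) \<le> norm (w y) * E y"
        unfolding E_def sum_distrib_left
        by (rule sum_norm_le) (auto intro!: mult_right_mono Basis_le_norm)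
      also have "norm (w y) * E y \<le> (norm (w y0) + norm (w y - w y0)) * E y"
        using norm_triangle_sub[of "w y" "w y0"] Epos by (intro mult_right_mono) auto
      also have "\<dots> \<le> norm (w y0) * E y + norm (w y - w y0) * (c / 2)"
        using mult_left_mono[of "E y" "c / 2" "norm (w y - w y0)"] elim by (simp add: distrib_right)
      finally show ?case using c(1) by (simp add: field_simps)
    qed
  qed
  moreover have "((\<lambda>y. (2 / c) * (norm (v y - v y0) + norm (w y0) * E y)) \<longlongrightarrow> 0) (at y0)"
  proof (rule tendsto_eq_rhs)
    show "((\<lambda>y. (2 / c) * (norm (v y - v y0) + norm (w y0) * E y)) \<longlongrightarrow> (2 / c) * (0 + norm (w y0) * 0)) (at y0)"
      by (intro tendsto_intros v0 E0)
  qed simp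
  ultimately have "((\<lambda>y. w y - w y0) \<longlongrightarrow> 0) (at y0)"
    by (rule Lim_null_comparison)
  then show ?thesis unfolding isCont_def by (rule LIM_zero_cancel)
qed

lemma Ck_linear_solve:
  fixes M :: "'a::real_normed_vector \<Rightarrow> 'b::euclidean_space \<Rightarrow> 'b"
  assumes T: "open T"
    and lin: "\<And>y. y \<in> T \<Longrightarrow> linear (M y)" and inj: "\<And>y. y \<in> T \<Longrightarrow> inj (M y)"
    and M: "\<And>b. Ck k T (\<lambda>y. M y b)" and v: "Ck k T v"
    and eq: "\<And>y. y \<in> T \<Longrightarrow> M y (w y) = v y"
  shows "Ck k T w"
  using M v eq
proof (induction k arbitrary: v w)
  case 0
  have "isCont w y0" if "y0 \<in> T" for y0
    by (rule linear_solve_isCont[of T y0 M w v])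
      (use T that lin inj 0 in \<open>auto simp: continuous_on_eq_continuous_at\<close>)
  then show ?case by (simp add: continuous_at_imp_continuous_on)
next
  case (Suc k)
  have w: "Ck k T w"
    by (rule Suc.IH[of v]) (use Suc.prems Ck_pred in blast)+
  have wC: "isCont w y" if "y \<in> T" for y
    using Ck_continuous[OF w] T that by (simp add: continuous_on_eq_continuous_at)
  have "\<exists>B. linear B \<and> (\<forall>x. B (M y x) = x) \<and> (\<forall>x. M y (B x) = x)" if "y \<in> T" for y
    using linear_injective_isomorphism[OF lin[OF that] inj[OF that]] by blast
  then obtain B where B: "\<And>y. y \<in> T \<Longrightarrow> linear (B y)" "\<And>y x. y \<in> T \<Longrightarrow> B y (M y x) = x"
    "\<And>y x. y \<in> T \<Longrightarrow> M y (B y x) = x" by metis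
  \<comment> \<open>The right-hand side found by formally differentiating
    \<open>M y (w y) = v y\<close> in direction \<open>h\<close>; it involves \<open>w\<close> but
    no derivative of \<open>w\<close>.\<close>
  define R where "R h y = dd h v y - (\<Sum>b\<in>Basis. (w y \<bullet> b) *\<^sub>R dd h (\<lambda>y. M y b) y)" for h y
  have "(w has_derivative (\<lambda>h. B y0 (R h y0))) (at y0)" if y0: "y0 \<in> T" for y0
  proof -
    have d: "((\<lambda>y. (w y \<bullet> b) *\<^sub>R (M y b - M y0 b)) has_derivative (\<lambda>h. (w y0 \<bullet> b) *\<^sub>R dd h (\<lambda>y. M y b) y0)) (at y0)" for b
      by (rule has_derivative_scaleR_vanishing)
         (auto intro!: continuous_intros wC y0 derivative_eq_intros dd_has_derivative[OF T Suc.prems(1) y0])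
    have "((\<lambda>y. w y0 + B y0 (v y - v y0 - (\<Sum>b\<in>Basis. (w y \<bullet> b) *\<^sub>R (M y b - M y0 b))))
      has_derivative (\<lambda>h. 0 + B y0 (dd h v y0 - 0 - (\<Sum>b\<in>Basis. (w y0 \<bullet> b) *\<^sub>R dd h (\<lambda>y. M y b) y0)))) (at y0)"
      using B(1)[OF y0]
      by (intro has_derivative_add has_derivative_const has_derivative_diff has_derivative_sum d
          bounded_linear.has_derivative[of "B y0"] dd_has_derivative[OF T Suc.prems(2) y0])
        (simp add: linear_conv_bounded_linear)
    then have "((\<lambda>y. w y0 + B y0 (v y - v y0 - (\<Sum>b\<in>Basis. (w y \<bullet> b) *\<^sub>R (M y b - M y0 b))))
      has_derivative (\<lambda>h. B y0 (R h y0))) (at y0)"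
      by (simp add: R_def)
    then show ?thesis
    proof (rule has_derivative_transform_within_open[OF _ T y0])
      fix y assume y: "y \<in> T"
      have "B y0 (M y0 (w y - w y0)) = B y0 (v y - v y0 - (\<Sum>b\<in>Basis. (w y \<bullet> b) *\<^sub>R (M y b - M y0 b)))"
        by (subst linear_solve_expand[of M y y0 w v]) (use lin Suc.prems(3) y y0 in auto)
      then show "w y0 + B y0 (v y - v y0 - (\<Sum>b\<in>Basis. (w y \<bullet> b) *\<^sub>R (M y b - M y0 b))) = w y"
        using B(2)[OF y0] by (metis add_diff_cancel_left' diff_add_cancel add.commute)
    qed
  qed
  moreover have "Ck k T (\<lambda>y. B y (R h y))" for h
  proof (rule Suc.IH)
    show "Ck k T (R h)" unfolding R_def
      using Suc.prems w by (intro Ck_diff Ck_sum Ck_scaleR Ck_inner Ck_const T) auto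
    show "Ck k T (\<lambda>y. M y b)" for b using Ck_pred[OF Suc.prems(1)] .
  qed (use B in auto)
  ultimately show ?case by (rule Ck_Suc[OF T])
qed

text \<open>The derivative of \<open>g\<close> solves a linear system whose coefficients are
  derivatives of \<open>f\<close> at \<open>g y\<close>. These are as regular as \<open>g\<close>,
  so the regularity of \<open>g\<close> rises by one order at a time.\<close>

lemma Ck_local_inverse:
  fixes f g :: "'a::euclidean_space \<Rightarrow> 'a"
  assumes S: "open S" and T: "open T" and f: "\<And>k. Ck k S f" and gT: "g ` T \<subseteq> S"
    and fg: "\<And>y. y \<in> T \<Longrightarrow> f (g y) = y"
    and g: "\<And>y. y \<in> T \<Longrightarrow> (g has_derivative g' y) (at y)"
    and inj: "\<And>y. y \<in> T \<Longrightarrow> inj (\<lambda>v. dd v f (g y))"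
  shows "Ck k T g"
proof (induction k)
  case 0
  then show ?case using g by (auto intro!: continuous_at_imp_continuous_on has_derivative_continuous)
next
  case (Suc k)
  show ?case
  proof (rule Ck_Suc[OF T g])
    fix v
    show "Ck k T (\<lambda>y. g' y v)"
    proof (rule Ck_linear_solve[OF T, of "\<lambda>y v. dd v f (g y)" _ "\<lambda>_. v"])
      fix y assume y: "y \<in> T"
      then have gy: "g y \<in> S" using gT by auto
      show "linear (\<lambda>v. dd v f (g y))"
        using dd_linear[OF S f gy] by (simp add: bounded_linear.linear)
      show "inj (\<lambda>v. dd v f (g y))" by (rule inj[OF y])
      have "((\<lambda>y. f (g y)) has_derivative (\<lambda>v. dd (g' y v) f (g y))) (at y)"
        by (rule has_derivative_compose[OF g[OF y] dd_has_derivative[OF S f gy]])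
      moreover have "((\<lambda>y. f (g y)) has_derivative (\<lambda>v. v)) (at y)"
        by (rule has_derivative_transform_within_open[OF has_derivative_ident T y]) (simp add: fg)
      ultimately show "dd (g' y v) f (g y) = v"
        by (metis has_derivative_unique)
    next
      fix b show "Ck k T (\<lambda>y. dd b f (g y))"
        by (rule Ck_compose[OF T S gT Suc]) (rule Ck_dd[OF f])
    qed (rule Ck_const[OF T])
  qed
qed

subsection \<open>The maximum principle for the support function\<close>

text \<open>A positive \<open>g2\<close> would make \<open>g'\<close> positive just to the right of
  the critical point 0, and the mean value theorem would produce a larger value of
  \<open>g\<close>.\<close>

lemma second_derivative_local_max_nonpos:
  fixes g :: "real \<Rightarrow> real"
  assumes d: "d > 0"
    and g: "\<And>s. \<bar>s\<bar> < d \<Longrightarrow> (g has_real_derivative g' s) (at s)"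
    and g': "(g' has_real_derivative g2) (at 0)"
    and max: "\<And>s. \<bar>s\<bar> < d \<Longrightarrow> g s \<le> g 0"
  shows "g2 \<le> 0"
proof (rule ccontr)
  assume "\<not> g2 \<le> 0"
  then obtain d' where d': "d' > 0" "\<And>h. 0 < h \<Longrightarrow> h < d' \<Longrightarrow> g' 0 < g' (0 + h)"
    using DERIV_pos_inc_right[OF g'] by auto
  have "g' 0 = 0"
    by (rule DERIV_local_max[OF g[of 0] d]) (use d max in auto)
  define h where "h = min d d' / 2"
  have h: "0 < h" "h < d" "h < d'" using d d'(1) by (auto simp: h_def)
  obtain z where z: "0 < z" "z < h" "g h - g 0 = (h - 0) * g' z"
    using MVT2[OF h(1), of g g'] g h by auto
  then have "g h - g 0 > 0" using d'(2)[of z] h \<open>g' 0 = 0\<close> by simp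
  then show False using max[of h] h by simp
qed

text \<open>Differentiating Euler's relation lowers the degree of homogeneity by one.\<close>

lemma euler_dd:
  fixes f :: "real \<times> 'a::euclidean_space \<Rightarrow> 'b::euclidean_space"
  assumes W: "open W" and f: "Ck (Suc (Suc k)) W f"
    and euler: "\<And>t z. (t, z) \<in> W \<Longrightarrow> dd (0, z) f (t, z) = c *\<^sub>R f (t, z)"
    and x: "(t, z) \<in> W"
  shows "dd (0, z) (dd (0, j) f) (t, z) = (c - 1) *\<^sub>R dd (0, j) f (t, z)"
proof -
  define l :: "real \<Rightarrow> real \<times> 'a" where "l s = (t, z) + s *\<^sub>R (0, j)" for s
  have l0: "l 0 \<in> W" using x by (simp add: l_def)
  have "isCont l 0" unfolding l_def by (intro continuous_intros)
  then have "\<forall>\<^sub>F s in nhds 0. l s \<in> W"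
    using W l0 unfolding isCont_def tendsto_def by (metis eventually_nhds_conv_at)
  then obtain I where I: "open I" "0 \<in> I" "\<And>s. s \<in> I \<Longrightarrow> l s \<in> W"
    unfolding eventually_nhds by blast
  have f1: "Ck (Suc k) W (dd v f)" for v using f Ck_dd by blast
  \<comment> \<open>Euler's relation at the shifted point uses the shifted direction
    \<open>z + s *\<^sub>R j\<close>. The resulting extra term, differentiated at s = 0, is what
    lowers the degree by one.\<close>
  have *: "c *\<^sub>R f (l s) = dd (0, z) f (l s) + s *\<^sub>R dd (0, j) f (l s)" if "s \<in> I" for s
  proof -
    interpret bounded_linear "\<lambda>v. dd v f (l s)" by (rule dd_linear[OF W f I(3)[OF that]])
    have "c *\<^sub>R f (l s) = dd (0, z + s *\<^sub>R j) f (l s)"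
      using euler[of t "z + s *\<^sub>R j"] I(3)[OF that] by (simp add: l_def)
    also have "(0, z + s *\<^sub>R j) = (0, z) + s *\<^sub>R (0 :: real, j)" by simp
    finally show ?thesis by (simp only: add scaleR)
  qed
  have d: "((\<lambda>s. g (l s)) has_vector_derivative dd (0, j) g (t, z)) (at 0)"
    if "Ck (Suc k') W g" for g :: "real \<times> 'a \<Rightarrow> 'b" and k'
    unfolding l_def using dd_line[OF W that, of "(t, z)" 0 "(0, j)"] x by simp
  have "((\<lambda>s. dd (0, z) f (l s) + s *\<^sub>R dd (0, j) f (l s)) has_vector_derivative
     dd (0, j) (dd (0, z) f) (t, z) + (0 *\<^sub>R dd (0, j) (dd (0, j) f) (t, z) + 1 *\<^sub>R dd (0, j) f (l 0))) (at 0)"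
    by (intro has_vector_derivative_add d[OF f1] has_vector_derivative_scaleR DERIV_ident)
  moreover have "((\<lambda>s. dd (0, z) f (l s) + s *\<^sub>R dd (0, j) f (l s)) has_vector_derivative c *\<^sub>R dd (0, j) f (t, z)) (at 0)"
    by (rule has_vector_derivative_transform_within_open[OF _ I(1,2) *])
       (auto intro!: derivative_eq_intros d[OF f])
  ultimately have "dd (0, j) (dd (0, z) f) (t, z) + dd (0, j) f (t, z) = c *\<^sub>R dd (0, j) f (t, z)"
    using vector_derivative_unique_at by (fastforce simp: l_def)
  then show ?thesis
    using dd_commute[OF W f x, of "(0, j)" "(0, z)"] by (simp add: algebra_simps)
qed

text \<open>\<open>bound\<close> says that \<open>q\<close> is a maximum of r1 - r2 up to time
  \<open>t0\<close>, phrased for all orthonormal frames orthogonal to \<open>z\<close>. It is tested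
  on the fixed frame at earlier times and on two rotating frames at time \<open>t0\<close>.\<close>

lemma max_principle_heat:
  fixes H :: "real \<times> (real^3) \<Rightarrow> real" and e1 e2 e3 :: "real^3" and t0 s0 :: real
  defines "q \<equiv> dd (0, e1) (dd (0, e1) H) (t0, e3) - dd (0, e2) (dd (0, e2) H) (t0, e3)"
  assumes W: "open W" and H: "\<And>k. Ck k W H"
    and euler: "\<And>t z w. (t, z) \<in> W \<Longrightarrow> dd (0, z) (dd (0, w) H) (t, z) = 0"
    and pde: "\<And>t z. (t, z) \<in> W \<Longrightarrow> dd (1, 0) H (t, z) = (z \<bullet> z) *
      (dd (0, e1) (dd (0, e1) H) (t, z) + dd (0, e2) (dd (0, e2) H) (t, z) + dd (0, e3) (dd (0, e3) H) (t, z))"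
    and on: "norm e1 = 1" "norm e2 = 1" "norm e3 = 1" "e1 \<bullet> e2 = 0" "e1 \<bullet> e3 = 0" "e2 \<bullet> e3 = 0"
    and P: "(t0, e3) \<in> W" and t: "s0 < t0" and q: "q > 0"
    and bound: "\<And>t z u v. (t, z) \<in> W \<Longrightarrow> s0 \<le> t \<Longrightarrow> t \<le> t0 \<Longrightarrow> norm u = 1 \<Longrightarrow> norm v = 1 \<Longrightarrow>
      u \<bullet> v = 0 \<Longrightarrow> u \<bullet> z = 0 \<Longrightarrow> v \<bullet> z = 0 \<Longrightarrow>
      norm z * (dd (0, u) (dd (0, u) H) (t, z) - dd (0, v) (dd (0, v) H) (t, z)) \<le> q"
  shows False
proof -
  let ?P = "(t0, e3)"
  have Ck_dd': "(\<And>k. Ck k W f) \<Longrightarrow> Ck k W (dd v f)" for f :: "real \<times> (real^3) \<Rightarrow> real" and k v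
    using Ck_dd by blast
  note Hs = H Ck_dd'[OF H] Ck_dd'[OF Ck_dd'[OF H]] Ck_dd'[OF Ck_dd'[OF Ck_dd'[OF H]]]
  have e_inner: "e1 \<bullet> e2 = 0" "e1 \<bullet> e3 = 0" "e2 \<bullet> e3 = 0" "e2 \<bullet> e1 = 0" "e3 \<bullet> e1 = 0" "e3 \<bullet> e2 = 0"
    using on by (auto simp: inner_commute)
  have ee: "e1 \<bullet> e1 = 1" "e2 \<bullet> e2 = 1" "e3 \<bullet> e3 = 1" using on by (auto simp: dot_square_norm)
  have swap: "dd a (dd b f) y = dd b (dd a f) y" if "\<And>k. Ck k W f" "y \<in> W"
    for a b y and f :: "real \<times> (real^3) \<Rightarrow> real"
    by (rule dd_commute[OF W that])
  have swap4: "dd a (dd a (dd b (dd b H))) y = dd b (dd b (dd a (dd a H))) y" if y: "y \<in> W" for a b y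
  proof -
    have s3: "dd a (dd b (dd b H)) x = dd b (dd b (dd a H)) x" if x: "x \<in> W" for x
      using swap[OF Hs(2) x, where a = a and b = b] dd_cong[OF W x swap[OF H, where a = a and b = b]] by simp
    have "dd a (dd a (dd b (dd b H))) y = dd a (dd b (dd b (dd a H))) y"
      by (rule dd_cong[OF W y s3])
    also have "\<dots> = dd b (dd a (dd b (dd a H))) y"
      by (rule swap[OF Hs(3) y])
    also have "\<dots> = dd b (dd b (dd a (dd a H))) y"
      by (rule dd_cong[OF W y swap[OF Hs(2)]])
    finally show ?thesis .
  qed
  \<comment> \<open>Second derivatives of \<open>H\<close> have degree -1 and third derivatives
    degree -2. Two radial derivatives of a second derivative therefore give the factor (-1)(-2) = 2
    in \<open>LL\<close>.\<close>
  have deg1: "dd (0, z) (dd (0, j) (dd (0, i) H)) (t, z) = (0 - 1) *\<^sub>R dd (0, j) (dd (0, i) H) (t, z)"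
    if "(t, z) \<in> W" for t z i j
    by (rule euler_dd[OF W Hs(2) _ that]) (simp add: euler)
  have deg2: "dd (0, z) (dd (0, k) (dd (0, j) (dd (0, i) H))) (t, z)
      = (0 - 1 - 1) *\<^sub>R dd (0, k) (dd (0, j) (dd (0, i) H)) (t, z)" if "(t, z) \<in> W" for t z i j k
    by (rule euler_dd[OF W Hs(3) deg1 that])

  define L where "L = (\<lambda>y. dd (0, e1) (dd (0, e1) H) y + dd (0, e2) (dd (0, e2) H) y + dd (0, e3) (dd (0, e3) H) y)"
  have L: "Ck k W L" for k unfolding L_def by (intro Ck_add W Hs(3))
  have LL: "dd (0, e) (dd (0, e) L) ?P = dd (0, e1) (dd (0, e1) (dd (0, e) (dd (0, e) H))) ?P
     + dd (0, e2) (dd (0, e2) (dd (0, e) (dd (0, e) H))) ?P + 2 * dd (0, e) (dd (0, e) H) ?P" for e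
  proof -
    have 1: "dd v L y = dd v (dd (0, e1) (dd (0, e1) H)) y + dd v (dd (0, e2) (dd (0, e2) H)) y
        + dd v (dd (0, e3) (dd (0, e3) H)) y" if "y \<in> W" for y v
      unfolding L_def using that
      by (subst dd_add[OF W _ _ that], (intro Ck_add W Hs(3))+)+ simp
    have "dd v (dd v L) ?P = dd v (dd v (dd (0, e1) (dd (0, e1) H))) ?P + dd v (dd v (dd (0, e2) (dd (0, e2) H))) ?P
        + dd v (dd v (dd (0, e3) (dd (0, e3) H))) ?P" for v
      by (subst dd_cong[OF W P 1], assumption, (subst dd_add[OF W _ _ P], (intro Ck_add W Hs(4))+)+) simp
    moreover have "dd (0, e3) (dd (0, e3) (dd (0, e) (dd (0, e) H))) ?P = 2 * dd (0, e) (dd (0, e) H) ?P"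
      using deg2[OF P] deg1[OF P] by simp
    ultimately show ?thesis using swap4[OF P, of "(0, e)"] by simp
  qed

  define S where "S = (\<lambda>y::real \<times> (real^3). snd y \<bullet> snd y)"
  have snd: "Ck k W (snd :: real \<times> (real^3) \<Rightarrow> real^3)" for k by (rule Ck_linear[OF W bounded_linear_snd])
  have S: "Ck k W S" for k unfolding S_def by (intro Ck_inner W snd)
  have ddS: "dd (0, e) S y = 2 * (snd y \<bullet> e)" if "y \<in> W" for y e
    unfolding S_def using that
    by (subst dd_inner[OF W snd snd that]) (simp add: dd_eqI[OF bounded_linear_imp_has_derivative[OF bounded_linear_snd]] inner_commute)
  \<comment> \<open>In the product \<open>S y * L y\<close> the first derivative of \<open>S\<close>
    in direction \<open>e\<close> vanishes at \<open>e3\<close> and the second equals 2, which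
    accounts for the term \<open>2 * L ?P\<close>.\<close>
  have time: "dd (1, 0) (dd (0, e) (dd (0, e) H)) ?P = 2 * L ?P + dd (0, e) (dd (0, e) L) ?P"
    if e: "e \<bullet> e = 1" "e3 \<bullet> e = 0" for e
  proof -
    have "dd (1, 0) (dd (0, e) (dd (0, e) H)) ?P = dd (0, e) (dd (1, 0) (dd (0, e) H)) ?P"
      by (rule swap[OF Hs(2) P])
    also have "\<dots> = dd (0, e) (dd (0, e) (dd (1, 0) H)) ?P"
      by (rule dd_cong[OF W P swap[OF H]])
    also have "\<dots> = dd (0, e) (dd (0, e) (\<lambda>y. S y * L y)) ?P"
    proof (intro dd_cong[OF W P] dd_cong[OF W])
      fix y assume "y \<in> W"
      then show "dd (1, 0) H y = S y * L y"
        using pde[of "fst y" "snd y"] by (simp add: S_def L_def)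
    qed
    also have "\<dots> = dd (0, e) (\<lambda>y. S y * dd (0, e) L y + (2 * (snd y \<bullet> e)) * L y) ?P"
      by (rule dd_cong[OF W P], subst dd_mult[OF W S L]) (auto simp: ddS)
    also have "\<dots> = dd (0, e) (\<lambda>y. S y * dd (0, e) L y) ?P + dd (0, e) (\<lambda>y. (2 * (snd y \<bullet> e)) * L y) ?P"
      by (rule dd_add[OF W _ _ P]; intro Ck_mult Ck_inner Ck_const W S L Ck_dd'[OF L] snd)
    also have "dd (0, e) (\<lambda>y. S y * dd (0, e) L y) ?P = dd (0, e) (dd (0, e) L) ?P"
      by (subst dd_mult[OF W S Ck_dd'[OF L] P]) (use e ddS[OF P, of e] ee in \<open>simp add: S_def\<close>)
    also have "dd (0, e) (\<lambda>y. (2 * (snd y \<bullet> e)) * L y) ?P = 2 * L ?P"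
    proof -
      have "dd (0, e) (\<lambda>y::real \<times> (real^3). 2 * (snd y \<bullet> e)) ?P = 2"
        by (rule trans[OF dd_eqI], rule bounded_linear_imp_has_derivative)
           (auto intro!: bounded_linear_intros bounded_linear_compose[OF bounded_linear_inner_left bounded_linear_snd] simp: e)
      moreover have "Ck (Suc 0) W (\<lambda>y. 2 * (snd y \<bullet> e))"
        by (intro Ck_mult Ck_inner Ck_const W snd)
      ultimately show ?thesis
        by (simp add: dd_mult[OF W _ L P] e del: Ck.simps)
    qed
    finally show ?thesis by simp
  qed

  have "isCont (\<lambda>s. (s, e3)) t0" by (intro continuous_intros)
  then have "\<forall>\<^sub>F s in nhds t0. (s, e3) \<in> W"
    using W P unfolding isCont_def tendsto_def by (metis eventually_nhds_conv_at)
  then obtain dt where dt: "dt > 0" "\<And>s. dist s t0 < dt \<Longrightarrow> (s, e3) \<in> W"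
    unfolding eventually_nhds_metric by blast
  define Q where "Q = (\<lambda>s. dd (0, e1) (dd (0, e1) H) (s, e3) - dd (0, e2) (dd (0, e2) H) (s, e3))"
  have Qd: "(Q has_real_derivative dd (1, 0) (dd (0, e1) (dd (0, e1) H)) ?P - dd (1, 0) (dd (0, e2) (dd (0, e2) H)) ?P) (at t0)"
  proof -
    have "((\<lambda>s. f ((0, e3) + s *\<^sub>R (1, 0))) has_real_derivative dd (1, 0) f ?P) (at t0)"
      if "\<And>k. Ck k W f" for f
      using dd_line_real[OF W that, of "(0, e3)" t0 "(1, 0)"] P by simp
    from DERIV_diff[OF this[OF Hs(3)] this[OF Hs(3)]] show ?thesis unfolding Q_def by simp
  qed
  \<comment> \<open>Only earlier times are compared, with the point \<open>e3\<close> and the frame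
    held fixed: a negative derivative would give \<open>Q (t0 - h) > q\<close> for some time after
    \<open>s0\<close>.\<close>
  have time_nonneg: "dd (1, 0) (dd (0, e1) (dd (0, e1) H)) ?P - dd (1, 0) (dd (0, e2) (dd (0, e2) H)) ?P \<ge> 0"
  proof (rule ccontr)
    assume "\<not> ?thesis"
    then obtain d where d: "d > 0" "\<And>h. 0 < h \<Longrightarrow> h < d \<Longrightarrow> Q t0 < Q (t0 - h)"
      using DERIV_neg_dec_left[OF Qd] by auto
    define h where "h = min d (min dt (t0 - s0)) / 2"
    have h: "0 < h" "h < d" "h < dt" "h < t0 - s0" using d(1) dt(1) t by (auto simp: h_def)
    have "Q (t0 - h) \<le> q"
      using bound[of "t0 - h" e3 e1 e2] dt(2)[of "t0 - h"] h on by (simp add: Q_def dist_real_def)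
    then show False using d(2)[OF h(1,2)] by (simp add: Q_def q_def)
  qed

  \<comment> \<open>The direction \<open>e'\<close> stays fixed while the pair of \<open>e3\<close>
    and \<open>e\<close> is rotated. The sign \<open>\<sigma>\<close> is 1 if \<open>e\<close>
    belongs to the larger radius and -1 if it belongs to the smaller one, so one computation serves
    both rotations.\<close>
  have space: "\<sigma> * (dd (0, e) (dd (0, e) (dd (0, e) (dd (0, e) H))) ?P - dd (0, e) (dd (0, e) (dd (0, e') (dd (0, e') H))) ?P
      + 2 * dd (0, e) (dd (0, e) H) ?P) + q \<le> 0"
    if e: "e \<bullet> e = 1" "e \<bullet> e3 = 0" "e' \<bullet> e' = 1" "e' \<bullet> e = 0" "e' \<bullet> e3 = 0"
      and s: "\<sigma> = 1 \<or> \<sigma> = -1"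
      and qe: "q = \<sigma> * (dd (0, e) (dd (0, e) H) ?P - dd (0, e') (dd (0, e') H) ?P)" for e e' \<sigma>
  proof -
    define A where "A = dd (0, e) (dd (0, e) H)"
    define B where "B = dd (0, e') (dd (0, e') H)"
    define l where "l s = ?P + s *\<^sub>R (0, e)" for s
    have ACk: "Ck k W A" and BCk: "Ck k W B" for k unfolding A_def B_def by (rule Hs(3))+
    have "isCont l 0" unfolding l_def by (intro continuous_intros)
    then have "\<forall>\<^sub>F s in nhds 0. l s \<in> W"
      using W P unfolding isCont_def tendsto_def by (metis (no_types, lifting) add.right_neutral eventually_nhds_conv_at l_def scale_eq_0_iff)
    then obtain d where d: "d > 0" "\<And>s. \<bar>s\<bar> < d \<Longrightarrow> l s \<in> W"
      unfolding eventually_nhds_metric by (auto simp: dist_real_def)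
    have line: "((\<lambda>s. f (l s)) has_real_derivative dd (0, e) f (l s)) (at s)" if "\<And>k. Ck k W f" "\<bar>s\<bar> < d" for f s
      using dd_line_real[OF W that(1), of ?P s "(0, e)"] d(2)[OF that(2)] unfolding l_def by simp
    \<comment> \<open>This is \<open>\<sigma>\<close> times the difference of the second derivatives
      of \<open>H\<close> in the rotated frame; the factor \<open>norm z\<close> of
      \<open>bound\<close> becomes \<open>sqrt (1 + s\<^sup>2)\<close> and is kept separate.\<close>
    define \<psi> where "\<psi> s = \<sigma> * ((1 + s\<^sup>2) * A (l s) - B (l s))" for s
    define \<psi>' where "\<psi>' s = \<sigma> * (2 * s * A (l s) + (1 + s\<^sup>2) * dd (0, e) A (l s) - dd (0, e) B (l s))" for s
    have l0: "l 0 = ?P" by (simp add: l_def)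
    have psi1: "(\<psi> has_real_derivative \<psi>' s) (at s)" if "\<bar>s\<bar> < d" for s
      unfolding \<psi>_def \<psi>'_def
      by (auto intro!: derivative_eq_intros line[OF ACk that] line[OF BCk that])
    define D2 where "D2 = \<sigma> * (2 * A ?P + dd (0, e) (dd (0, e) A) ?P - dd (0, e) (dd (0, e) B) ?P)"
    have psi2: "(\<psi>' has_real_derivative D2) (at 0)"
      unfolding \<psi>'_def D2_def using d
      by (auto intro!: derivative_eq_intros line[OF ACk] line[OF Ck_dd'[OF ACk]] line[OF Ck_dd'[OF BCk]] simp: l0)
    have psi_le: "sqrt (1 + s\<^sup>2) * \<psi> s \<le> q" if sd: "\<bar>s\<bar> < d" for s
    proof -
      let ?r = "sqrt (1 + s\<^sup>2)" and ?z = "e3 + s *\<^sub>R e"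
      define u where "u = (1 / ?r) *\<^sub>R (e - s *\<^sub>R e3)"
      have r: "?r > 0" "?r * ?r = 1 + s\<^sup>2" by (simp_all add: add_pos_nonneg)
      have lW: "(t0, ?z) \<in> W" and ls: "l s = (t0, ?z)" using d(2)[OF sd] by (simp_all add: l_def)
      have "norm ?z = ?r"
        unfolding norm_eq_sqrt_inner using e ee by (simp add: inner_add_left inner_add_right inner_commute power2_eq_square)
      have "norm (e - s *\<^sub>R e3) = ?r"
        unfolding norm_eq_sqrt_inner using e ee by (simp add: inner_diff_left inner_diff_right inner_commute power2_eq_square)
      then have u1: "norm u = 1" using r by (simp add: u_def)
      have uz: "u \<bullet> ?z = 0" "u \<bullet> e' = 0" "e' \<bullet> ?z = 0"
        using e ee by (simp_all add: u_def inner_diff_left inner_diff_right inner_add_left inner_add_right inner_commute)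
      have e'1: "norm e' = 1" using e by (simp add: norm_eq_sqrt_inner)
      \<comment> \<open>Up to a multiple of the radial vector \<open>?z\<close>, which the Hessian
        kills, \<open>u\<close> is \<open>?r\<close> times \<open>e\<close>. Hence the rotation
        contributes only the scalar factor 1 + s^2 and no mixed derivatives.\<close>
      have ueq: "(0, u) = ?r *\<^sub>R (0 :: real, e) - (s / ?r) *\<^sub>R (0, ?z)"
      proof -
        have "?r *\<^sub>R u = (?r * ?r) *\<^sub>R e - s *\<^sub>R ?z"
          using r unfolding u_def r(2) by (simp add: algebra_simps power2_eq_square)
        then have "(1 / ?r) *\<^sub>R (?r *\<^sub>R u) = (1 / ?r) *\<^sub>R ((?r * ?r) *\<^sub>R e - s *\<^sub>R ?z)" by simp
        then show ?thesis using r(1) by (simp add: scaleR_diff_right real_div_sqrt)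
      qed
      have ddu: "dd (0, u) (dd w H) (t0, ?z) = ?r * dd (0, e) (dd w H) (t0, ?z)" if "fst w = 0" for w
      proof -
        interpret bounded_linear "\<lambda>v. dd v (dd w H) (t0, ?z)" by (rule dd_linear[OF W Hs(2) lW])
        show ?thesis unfolding ueq using euler[OF lW, of "snd w"] that by (simp only: diff scaleR) (cases w; simp)
      qed
      have "dd (0, u) (dd (0, u) H) (t0, ?z) = ?r * (?r * A (t0, ?z))"
        using ddu[of "(0, u)"] ddu[of "(0, e)"] swap[OF H lW, where a = "(0, e)" and b = "(0, u)"] by (simp add: A_def)
      then have uu: "dd (0, u) (dd (0, u) H) (t0, ?z) = (1 + s\<^sup>2) * A (t0, ?z)"
        using r(2) by (simp only: mult.assoc[symmetric])
      show ?thesis using s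
      proof
        assume "\<sigma> = 1"
        then show ?thesis using bound[OF lW _ _ u1 e'1 uz(2,1,3)] uu t \<open>norm ?z = ?r\<close>
          by (simp add: \<psi>_def ls B_def)
      next
        assume "\<sigma> = -1"
        then show ?thesis using bound[OF lW _ _ e'1 u1 _ uz(3,1)] uz(2) uu t \<open>norm ?z = ?r\<close>
          by (simp add: \<psi>_def ls B_def inner_commute)
      qed
    qed
    have psi0: "\<psi> 0 = q" by (simp add: \<psi>_def qe l0 A_def B_def)
    have pos: "1 + s\<^sup>2 > 0" for s :: real by (simp add: add_pos_nonneg)
    have sqrt': "((\<lambda>s. sqrt (1 + s\<^sup>2)) has_real_derivative s / sqrt (1 + s\<^sup>2)) (at s)" for s
      using pos[of s] by (auto intro!: derivative_eq_intros simp: field_simps)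
    have sqrt'': "((\<lambda>s. s / sqrt (1 + s\<^sup>2)) has_real_derivative 1) (at 0)"
      by (auto intro!: derivative_eq_intros)
    \<comment> \<open>The root has value 1, first derivative 0 and second derivative 1 at s = 0, and
      \<open>\<psi> 0 = q\<close>; so the product has second derivative
      \<open>q + D2\<close>.\<close>
    have "((\<lambda>s. s / sqrt (1 + s\<^sup>2) * \<psi> s + \<psi>' s * sqrt (1 + s\<^sup>2)) has_real_derivative q + D2) (at 0)"
      by (rule DERIV_cong[OF DERIV_add[OF DERIV_mult[OF sqrt'' psi1] DERIV_mult[OF psi2 sqrt']]])
         (use d(1) psi0 in auto)
    with psi_le psi0 have "q + D2 \<le> 0"
      by (intro second_derivative_local_max_nonpos[OF d(1) DERIV_mult[OF sqrt' psi1]]) auto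
    then have "q + \<sigma> * (2 * A ?P + dd (0, e) (dd (0, e) A) ?P - dd (0, e) (dd (0, e) B) ?P) \<le> 0"
      unfolding D2_def .
    then show ?thesis by (simp add: A_def B_def algebra_simps)
  qed
  \<comment> \<open>With indices for derivatives along \<open>e1\<close> and \<open>e2\<close>, the
    two inequalities add up to H_1111 - H_2222 + 4 q \<le> 0, since the mixed terms cancel. The
    equation gives H_1111 - H_2222 + 2 q as the time derivative of H_11 - H_22, so this is at most
    -2 q < 0, against \<open>time_nonneg\<close>.\<close>
  have "1 * (dd (0, e1) (dd (0, e1) (dd (0, e1) (dd (0, e1) H))) ?P - dd (0, e1) (dd (0, e1) (dd (0, e2) (dd (0, e2) H))) ?P
      + 2 * dd (0, e1) (dd (0, e1) H) ?P) + q \<le> 0"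
    by (rule space) (auto simp: ee e_inner q_def)
  moreover have "(-1) * (dd (0, e2) (dd (0, e2) (dd (0, e2) (dd (0, e2) H))) ?P - dd (0, e2) (dd (0, e2) (dd (0, e1) (dd (0, e1) H))) ?P
      + 2 * dd (0, e2) (dd (0, e2) H) ?P) + q \<le> 0"
    by (rule space) (auto simp: ee e_inner q_def)
  ultimately show False
    using time_nonneg time[of e1] time[of e2] LL[of e1] LL[of e2] q ee e_inner
      swap4[OF P, of "(0, e1)" "(0, e2)"] unfolding q_def by (simp add: inner_commute)
qed

subsection \<open>Degenerate quadratic forms on three-space\<close>

text \<open>A nonzero remainder, being orthogonal to the three vectors, would give four independent
  vectors in three-space.\<close>

lemma orthonormal_triple_expand:
  fixes e1 e2 e3 x :: "real^3"
  assumes on: "norm e1 = 1" "norm e2 = 1" "norm e3 = 1" "e1 \<bullet> e2 = 0" "e1 \<bullet> e3 = 0" "e2 \<bullet> e3 = 0"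
  shows "x = (x \<bullet> e1) *\<^sub>R e1 + (x \<bullet> e2) *\<^sub>R e2 + (x \<bullet> e3) *\<^sub>R e3"
proof (rule ccontr)
  define y where "y = x - ((x \<bullet> e1) *\<^sub>R e1 + (x \<bullet> e2) *\<^sub>R e2 + (x \<bullet> e3) *\<^sub>R e3)"
  assume "\<not> ?thesis"
  then have y: "y \<noteq> 0" by (simp add: y_def)
  have ee: "e1 \<bullet> e1 = 1" "e2 \<bullet> e2 = 1" "e3 \<bullet> e3 = 1" using on by (auto simp: dot_square_norm)
  have o: "y \<bullet> e1 = 0" "y \<bullet> e2 = 0" "y \<bullet> e3 = 0"
    using on ee by (auto simp: y_def inner_diff_left inner_add_left inner_diff_right inner_add_right inner_commute)
  have ne: "e1 \<noteq> 0" "e2 \<noteq> 0" "e3 \<noteq> 0" using on by auto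
  have dist: "e1 \<noteq> e2" "e1 \<noteq> e3" "e2 \<noteq> e3" "y \<noteq> e1" "y \<noteq> e2" "y \<noteq> e3"
    using on ee o by auto
  have "pairwise orthogonal {y, e1, e2, e3}"
    using on o by (auto simp: pairwise_def orthogonal_def inner_commute)
  then have "independent {y, e1, e2, e3}"
    using y ne by (intro pairwise_orthogonal_independent) auto
  then have "card {y, e1, e2, e3} \<le> DIM(real^3)" by (rule independent_card_le)
  then show False using dist by simp
qed

lemma trace_orthonormal:
  fixes A :: "real^3 \<Rightarrow> real^3"
  assumes on: "norm e1 = 1" "norm e2 = 1" "norm e3 = 1" "e1 \<bullet> e2 = 0" "e1 \<bullet> e3 = 0" "e2 \<bullet> e3 = 0"
    and A: "linear A"
  shows "(\<Sum>b\<in>Basis. A b \<bullet> b) = A e1 \<bullet> e1 + A e2 \<bullet> e2 + A e3 \<bullet> e3"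
proof -
  have "A b \<bullet> b = (A e1 \<bullet> b) * (e1 \<bullet> b) + (A e2 \<bullet> b) * (e2 \<bullet> b) + (A e3 \<bullet> b) * (e3 \<bullet> b)" for b
  proof -
    have "A b = A ((b \<bullet> e1) *\<^sub>R e1 + (b \<bullet> e2) *\<^sub>R e2 + (b \<bullet> e3) *\<^sub>R e3)"
      using orthonormal_triple_expand[OF on, of b] by simp
    then show ?thesis
      by (simp add: linear_add[OF A] linear_cmul[OF A] inner_add_right inner_commute)
  qed
  then have "(\<Sum>b\<in>Basis. A b \<bullet> b) = (\<Sum>b\<in>Basis. (A e1 \<bullet> b) * (e1 \<bullet> b) + (A e2 \<bullet> b) * (e2 \<bullet> b) + (A e3 \<bullet> b) * (e3 \<bullet> b))"
    by (intro sum.cong) blast+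
  then show ?thesis unfolding sum.distrib euclidean_inner[symmetric] .
qed

lemma exists_orthonormal_pair:
  fixes z :: "real^3"
  assumes z: "z \<noteq> 0"
  shows "\<exists>u v. norm u = 1 \<and> norm v = 1 \<and> u \<bullet> v = 0 \<and> u \<bullet> z = 0 \<and> v \<bullet> z = 0"
proof -
  obtain y where y: "y \<noteq> 0" "orthogonal z y"
    using orthogonal_to_vector_exists[of z] by auto
  define u where "u = y /\<^sub>R norm y"
  define v where "v = cross3 (z /\<^sub>R norm z) u"
  have uz: "u \<bullet> z = 0" "norm u = 1" using y by (auto simp: u_def orthogonal_def inner_commute)
  have vz: "v \<bullet> z = 0" "u \<bullet> v = 0"
    unfolding v_def by (auto simp: cross3_def inner_vec_def sum_3 algebra_simps)
  have "(norm v)\<^sup>2 = (norm (z /\<^sub>R norm z))\<^sup>2 * (norm u)\<^sup>2 - ((z /\<^sub>R norm z) \<bullet> u)\<^sup>2"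
    unfolding v_def by (rule norm_cross)
  also have "\<dots> = 1" using z uz by (simp add: inner_commute)
  finally have "norm v = 1" using norm_ge_zero[of v] by (auto simp: power2_eq_1_iff)
  then show ?thesis using uz vz by blast
qed

text \<open>Models the Hessian at \<open>z\<close> of a function homogeneous of degree 1: symmetric,
  with \<open>z\<close> in its kernel, hence determined on the plane orthogonal to
  \<open>z\<close>.\<close>

locale degenerate_form =
  fixes A :: "real^3 \<Rightarrow> real^3" and z :: "real^3"
  assumes A: "linear A" and sym: "\<And>v w. A v \<bullet> w = v \<bullet> A w" and Az: "A z = 0" and z: "z \<noteq> 0"
begin

definition tr :: real where "tr = (\<Sum>b\<in>Basis. A b \<bullet> b)"

text \<open>For eigenvalues r1, r2, 0 this is 2 (r1^2 + r2^2) - (r1 + r2)^2 = (r1 - r2)^2. Being a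
  polynomial in the entries of \<open>A\<close>, it depends continuously on \<open>A\<close> without
  any choice of eigenvectors.\<close>

definition disc :: real where "disc = 2 * (\<Sum>b\<in>Basis. A b \<bullet> A b) - tr\<^sup>2"

definition ortho_pair :: "real^3 \<Rightarrow> real^3 \<Rightarrow> bool" where
  "ortho_pair u v \<longleftrightarrow> norm u = 1 \<and> norm v = 1 \<and> u \<bullet> v = 0 \<and> u \<bullet> z = 0 \<and> v \<bullet> z = 0"

lemma ortho_pair_expand:
  assumes "ortho_pair u v"
  shows "A u = (A u \<bullet> u) *\<^sub>R u + (A u \<bullet> v) *\<^sub>R v" "w \<bullet> z = 0 \<Longrightarrow> w = (w \<bullet> u) *\<^sub>R u + (w \<bullet> v) *\<^sub>R v"
proof -
  have on: "norm u = 1" "norm v = 1" "norm (z /\<^sub>R norm z) = 1" "u \<bullet> v = 0"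
    "u \<bullet> (z /\<^sub>R norm z) = 0" "v \<bullet> (z /\<^sub>R norm z) = 0"
    using assms z by (auto simp: ortho_pair_def)
  show *: "w = (w \<bullet> u) *\<^sub>R u + (w \<bullet> v) *\<^sub>R v" if "w \<bullet> z = 0" for w
    using orthonormal_triple_expand[OF on, of w] that by simp
  have "A u \<bullet> z = 0" by (simp add: sym Az)
  from *[OF this] show "A u = (A u \<bullet> u) *\<^sub>R u + (A u \<bullet> v) *\<^sub>R v" .
qed

lemma ortho_pair_flip: "ortho_pair u v \<Longrightarrow> ortho_pair v u"
  by (auto simp: ortho_pair_def inner_commute)

text \<open>The formula for \<open>disc\<close> shows that it dominates the squared difference of
  the diagonal entries in every frame, with equality in a principal frame. This converts a bound on
  the radii into a bound for arbitrary test frames.\<close>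

lemma tr_ortho_pair:
  assumes "ortho_pair u v"
  shows "tr = A u \<bullet> u + A v \<bullet> v" "disc = (A u \<bullet> u - A v \<bullet> v)\<^sup>2 + 4 * (A u \<bullet> v)\<^sup>2"
proof -
  have on: "norm u = 1" "norm v = 1" "norm (z /\<^sub>R norm z) = 1" "u \<bullet> v = 0"
    "u \<bullet> (z /\<^sub>R norm z) = 0" "v \<bullet> (z /\<^sub>R norm z) = 0"
    using assms z by (auto simp: ortho_pair_def)
  have uu: "u \<bullet> u = 1" "v \<bullet> v = 1" "v \<bullet> u = 0" using on by (auto simp: dot_square_norm inner_commute)
  show tr: "tr = A u \<bullet> u + A v \<bullet> v"
    unfolding tr_def trace_orthonormal[OF on A] by (simp add: linear_cmul[OF A] Az)
  have AA: "linear (\<lambda>x. A (A x))" using linear_compose[OF A A] by (simp add: o_def)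
  have "(\<Sum>b\<in>Basis. A b \<bullet> A b) = (\<Sum>b\<in>Basis. A (A b) \<bullet> b)" by (simp add: sym)
  also have "\<dots> = A (A u) \<bullet> u + A (A v) \<bullet> v"
    unfolding trace_orthonormal[OF on AA] by (simp add: linear_cmul[OF A] Az linear_0[OF A])
  also have "\<dots> = A u \<bullet> A u + A v \<bullet> A v" by (simp add: sym)
  also have "A u \<bullet> A u = (A u \<bullet> u)\<^sup>2 + (A u \<bullet> v)\<^sup>2"
    by (subst ortho_pair_expand(1)[OF assms], subst (3) ortho_pair_expand(1)[OF assms])
      (simp add: inner_add_left inner_add_right on uu power2_eq_square inner_commute)
  also have "A v \<bullet> A v = (A v \<bullet> v)\<^sup>2 + (A v \<bullet> u)\<^sup>2"
    by (subst ortho_pair_expand(1)[OF ortho_pair_flip[OF assms]], subst (3) ortho_pair_expand(1)[OF ortho_pair_flip[OF assms]])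
      (simp add: inner_add_left inner_add_right on uu power2_eq_square inner_commute)
  also have "A v \<bullet> u = A u \<bullet> v" by (metis sym inner_commute)
  finally show "disc = (A u \<bullet> u - A v \<bullet> v)\<^sup>2 + 4 * (A u \<bullet> v)\<^sup>2"
    unfolding disc_def tr by (simp add: power2_eq_square algebra_simps)
qed

lemma diagonalize: "\<exists>u v. ortho_pair u v \<and> A u \<bullet> v = 0 \<and> A v \<bullet> v \<le> A u \<bullet> u"
proof -
  obtain u v where uv: "ortho_pair u v"
    using exists_orthonormal_pair[OF z] unfolding ortho_pair_def by blast
  have uu: "u \<bullet> u = 1" "v \<bullet> v = 1" "v \<bullet> u = 0" "u \<bullet> v = 0" using uv by (auto simp: ortho_pair_def dot_square_norm inner_commute)
  let ?a = "A u \<bullet> u" and ?b = "A u \<bullet> v" and ?c = "A v \<bullet> v"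
  define D where "D = sqrt (((?a - ?c) / 2)\<^sup>2 + ?b\<^sup>2)"
  \<comment> \<open>\<open>\<phi>\<close> is the polar angle of the point ((?a - ?c)/2, ?b).
    Rotating the frame by half of it removes the off-diagonal entry and puts the larger eigenvalue
    first.\<close>
  obtain \<phi> where \<phi>: "(?a - ?c) / 2 = D * cos \<phi>" "?b = D * sin \<phi>"
  proof (cases "D = 0")
    case True
    then have "((?a - ?c) / 2)\<^sup>2 + ?b\<^sup>2 = 0" unfolding D_def by simp
    then have "(?a - ?c) / 2 = 0 \<and> ?b = 0" unfolding sum_power2_eq_zero_iff .
    then show ?thesis using that[of 0] True by simp
  next
    case False
    have "D\<^sup>2 = ((?a - ?c) / 2)\<^sup>2 + ?b\<^sup>2" unfolding D_def by simp
    then have "(((?a - ?c) / 2)\<^sup>2 + ?b\<^sup>2) / D\<^sup>2 = 1" using False by (metis divide_self power_not_zero)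
    then have "((?a - ?c) / 2 / D)\<^sup>2 + (?b / D)\<^sup>2 = 1"
      by (simp only: power_divide[of _ D] add_divide_distrib)
    then obtain \<phi> where "(?a - ?c) / 2 / D = cos \<phi>" "?b / D = sin \<phi>"
      using sincos_total_2pi by metis
    then show ?thesis using that[of \<phi>] False by (simp add: field_simps)
  qed
  have D: "D \<ge> 0" unfolding D_def by simp
  define C where "C = cos (\<phi> / 2)"
  define S where "S = sin (\<phi> / 2)"
  have CS: "C\<^sup>2 + S\<^sup>2 = 1" "cos \<phi> = C\<^sup>2 - S\<^sup>2" "sin \<phi> = 2 * S * C"
    using cos_double[of "\<phi> / 2"] sin_double[of "\<phi> / 2"] by (auto simp: C_def S_def)
  define u' where "u' = C *\<^sub>R u + S *\<^sub>R v"
  define v' where "v' = C *\<^sub>R v - S *\<^sub>R u"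
  have n: "u' \<bullet> u' = 1" "v' \<bullet> v' = 1"
    using CS(1) uu by (simp_all add: u'_def v'_def inner_add_left inner_add_right inner_diff_left inner_diff_right power2_eq_square)
  have op: "ortho_pair u' v'"
    using n uu uv unfolding ortho_pair_def
    by (auto simp: norm_eq_sqrt_inner) (auto simp: u'_def v'_def inner_add_left inner_add_right inner_diff_left inner_diff_right)
  have Avu: "A v \<bullet> u = ?b" by (metis sym inner_commute)
  have Au': "A u' = C *\<^sub>R A u + S *\<^sub>R A v" "A v' = C *\<^sub>R A v - S *\<^sub>R A u"
    by (simp_all add: u'_def v'_def linear_add[OF A] linear_diff[OF A] linear_cmul[OF A])
  have "A u' \<bullet> v' = ?b * (C\<^sup>2 - S\<^sup>2) - (?a - ?c) / 2 * (2 * S * C)"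
    unfolding Au' unfolding u'_def v'_def
    by (simp add: inner_add_left inner_diff_right Avu) (simp add: algebra_simps power2_eq_square)
  also have "\<dots> = 0" unfolding \<phi> CS(2,3)[symmetric] by simp
  finally have 1: "A u' \<bullet> v' = 0" .
  have "A u' \<bullet> u' - A v' \<bullet> v' = 2 * ((?a - ?c) / 2 * (C\<^sup>2 - S\<^sup>2) + ?b * (2 * S * C))"
    unfolding Au' unfolding u'_def v'_def
    by (simp add: inner_add_left inner_add_right inner_diff_left inner_diff_right Avu) (simp add: algebra_simps power2_eq_square)
  also have "\<dots> = 2 * D * ((cos \<phi>)\<^sup>2 + (sin \<phi>)\<^sup>2)"
    unfolding \<phi> CS(2,3)[symmetric] by algebra
  finally have 2: "A u' \<bullet> u' - A v' \<bullet> v' \<ge> 0" using D by simp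
  show ?thesis using op 1 2 by auto
qed

text \<open>In an eigenframe every ratio is a convex combination of 1/(a |z|) and 1/(c |z|), and
  both values occur. \<open>R\<close> is to become the set of normal curvatures: \<open>w\<close> is
  a variation of the normal and \<open>A w\<close> the corresponding variation of the
  position.\<close>

lemma ratio_bounds:
  assumes inj: "\<And>w. w \<bullet> z = 0 \<Longrightarrow> w \<noteq> 0 \<Longrightarrow> A w \<noteq> 0"
  defines "R \<equiv> {A w \<bullet> w / (norm z * (norm (A w))\<^sup>2) | w. w \<bullet> z = 0 \<and> w \<noteq> 0}"
  shows "bounded R" "(Sup R + Inf R) / (Sup R * Inf R) = norm z * tr"
    "(Sup R - Inf R)\<^sup>2 / (4 * (Sup R)\<^sup>2 * (Inf R)\<^sup>2) = (norm z)\<^sup>2 * disc / 4"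
proof -
  obtain u v where uv: "ortho_pair u v" "A u \<bullet> v = 0" using diagonalize by blast
  define a where "a = A u \<bullet> u"
  define c where "c = A v \<bullet> v"
  have Auv: "A u = a *\<^sub>R u" "A v = c *\<^sub>R v"
  proof -
    have "A v \<bullet> u = 0" using uv(2) by (metis sym inner_commute)
    then show "A u = a *\<^sub>R u" "A v = c *\<^sub>R v"
      using ortho_pair_expand(1)[OF uv(1)] ortho_pair_expand(1)[OF ortho_pair_flip[OF uv(1)]] uv(2)
      by (simp_all add: a_def c_def)
  qed
  have uu: "u \<bullet> u = 1" "v \<bullet> v = 1" "v \<bullet> u = 0" "u \<bullet> v = 0" "u \<noteq> 0" "v \<noteq> 0" "u \<bullet> z = 0" "v \<bullet> z = 0" "norm u = 1" "norm v = 1"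
    using uv by (auto simp: ortho_pair_def dot_square_norm inner_commute)
  have a0: "a \<noteq> 0" "c \<noteq> 0" using inj[of u] inj[of v] uu Auv by auto
  have nz: "norm z > 0" using z by simp
  let ?lo = "min (1 / a) (1 / c) / norm z" and ?hi = "max (1 / a) (1 / c) / norm z"
  have in1: "1 / a / norm z \<in> R" unfolding R_def
    by (rule CollectI, rule exI[of _ u]) (use uu Auv a0 nz in \<open>simp add: power2_eq_square\<close>)
  have in2: "1 / c / norm z \<in> R" unfolding R_def
    by (rule CollectI, rule exI[of _ v]) (use uu Auv a0 nz in \<open>simp add: power2_eq_square\<close>)
  have R: "?lo \<le> r \<and> r \<le> ?hi" if rR: "r \<in> R" for r
  proof -
    obtain w where w: "w \<bullet> z = 0" "w \<noteq> 0" "r = A w \<bullet> w / (norm z * (norm (A w))\<^sup>2)"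
      using rR unfolding R_def by blast
    define \<alpha> where "\<alpha> = w \<bullet> u"
    define \<beta> where "\<beta> = w \<bullet> v"
    have we: "w = \<alpha> *\<^sub>R u + \<beta> *\<^sub>R v" using ortho_pair_expand(2)[OF uv(1) w(1)] by (simp add: \<alpha>_def \<beta>_def)
    have Aw: "A w = (a * \<alpha>) *\<^sub>R u + (c * \<beta>) *\<^sub>R v"
      by (subst we) (simp add: linear_add[OF A] linear_cmul[OF A] Auv mult.commute)
    define p where "p = (a * \<alpha>)\<^sup>2"
    define s where "s = (c * \<beta>)\<^sup>2"
    have ps: "p \<ge> 0" "s \<ge> 0" by (simp_all add: p_def s_def)
    have n: "(norm (A w))\<^sup>2 = p + s"
      unfolding power2_norm_eq_inner Aw p_def s_def
      by (simp add: inner_add_left inner_add_right uu power2_eq_square)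
    then have pos: "p + s > 0" using inj[OF w(1,2)] by (metis zero_less_norm_iff zero_less_power)
    have "A w \<bullet> w = (a * \<alpha>) * \<alpha> + (c * \<beta>) * \<beta>"
      unfolding Aw by (subst we) (simp add: inner_add_left inner_add_right uu)
    also have "\<dots> = p * (1 / a) + s * (1 / c)"
      using a0 by (simp add: p_def s_def power2_eq_square)
    finally have r: "r = (p * (1 / a) + s * (1 / c)) / (p + s) / norm z"
      using w(3) n by simp
    have "(p + s) * min (1 / a) (1 / c) \<le> p * (1 / a) + s * (1 / c)"
      unfolding distrib_right using ps by (intro add_mono mult_left_mono) auto
    moreover have "p * (1 / a) + s * (1 / c) \<le> (p + s) * max (1 / a) (1 / c)"
      unfolding distrib_right using ps by (intro add_mono mult_left_mono) auto
    ultimately show ?thesis unfolding r using pos nz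
      by (auto intro!: divide_right_mono simp: pos_le_divide_eq pos_divide_le_eq mult.commute)
  qed
  have "?lo \<in> R" "?hi \<in> R" using in1 in2 by (auto simp: min_def max_def)
  then have I: "Inf R = ?lo" and S: "Sup R = ?hi"
    using R by (auto intro!: cInf_eq_minimum cSup_eq_maximum)
  show "bounded R"
  proof (rule boundedI)
    have "\<bar>r\<bar> \<le> max \<bar>lo\<bar> \<bar>hi\<bar>" if "lo \<le> r \<and> r \<le> hi" for lo hi r :: real
      using that by linarith
    from this[OF R] show "norm r \<le> max \<bar>?lo\<bar> \<bar>?hi\<bar>" if "r \<in> R" for r
      using that unfolding real_norm_def by blast
  qed
  have tr: "tr = a + c" "disc = (a - c)\<^sup>2" using tr_ortho_pair[OF uv(1)] uv(2) by (simp_all add: a_def c_def)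
  have s: "Sup R + Inf R = (1 / a + 1 / c) / norm z" "Sup R * Inf R = 1 / (a * c * (norm z)\<^sup>2)"
    "(Sup R - Inf R)\<^sup>2 = (1 / a - 1 / c)\<^sup>2 / (norm z)\<^sup>2"
  proof -
    have m: "max x y + min x y = x + y" "max x y * min x y = x * y" "(max x y - min x y)\<^sup>2 = (x - y)\<^sup>2" for x y :: real
      by (auto simp: min_def max_def power2_commute)
    show "Sup R + Inf R = (1 / a + 1 / c) / norm z"
      unfolding I S by (simp only: m flip: add_divide_distrib)
    show "Sup R * Inf R = 1 / (a * c * (norm z)\<^sup>2)"
      unfolding I S by (simp only: m times_divide_times_eq power2_eq_square) simp
    show "(Sup R - Inf R)\<^sup>2 = (1 / a - 1 / c)\<^sup>2 / (norm z)\<^sup>2"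
      unfolding I S by (simp only: m power_divide flip: diff_divide_distrib)
  qed
  show "(Sup R + Inf R) / (Sup R * Inf R) = norm z * tr"
    unfolding s tr using a0 nz by (simp add: field_simps power2_eq_square)
  have "(Sup R - Inf R)\<^sup>2 / (4 * (Sup R)\<^sup>2 * (Inf R)\<^sup>2) = (Sup R - Inf R)\<^sup>2 / (4 * (Sup R * Inf R)\<^sup>2)"
    by (simp add: power_mult_distrib)
  also have "\<dots> = (norm z)\<^sup>2 * disc / 4"
    unfolding s tr using a0 nz by (simp add: field_simps power2_eq_square)
  finally show "(Sup R - Inf R)\<^sup>2 / (4 * (Sup R)\<^sup>2 * (Inf R)\<^sup>2) = (norm z)\<^sup>2 * disc / 4" .
qed

end

subsection \<open>Curvature of the flowing surfaces\<close>

abbreviation dx :: "'a::real_normed_vector \<Rightarrow> (real \<times> 'a \<Rightarrow> 'b::real_normed_vector) \<Rightarrow> real \<times> 'a \<Rightarrow> 'b" where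
  "dx w \<equiv> dd (0, w)"

locale convex_flow =
  fixes X :: "real \<Rightarrow> real^3 \<Rightarrow> real^3"
    and nu :: "real \<Rightarrow> real^3 \<Rightarrow> real^3"
    and a b :: real and U :: "(real^3) set"
  assumes S2U: "S2 \<subseteq> U"
    and smooth: "smooth_on ({a<..<b} \<times> U) (\<lambda>(t, x). X t x)"
    and embedded: "\<And>t. t \<in> {a<..<b} \<Longrightarrow> embedded_sphere (X t)"
    and normal: "\<And>t. t \<in> {a<..<b} \<Longrightarrow> outer_unit_normal (X t) (nu t)"
    and convex: "\<And>t p. t \<in> {a<..<b} \<Longrightarrow> p \<in> S2 \<Longrightarrow> lam2 (X t) (nu t) p > 0"
    and flow: "\<And>t p. t \<in> {a<..<b} \<Longrightarrow> p \<in> S2 \<Longrightarrow>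
       ((\<lambda>s. X s p) has_vector_derivative
          ((lam1 (X t) (nu t) p + lam2 (X t) (nu t) p)
             / (lam1 (X t) (nu t) p * lam2 (X t) (nu t) p)) *\<^sub>R nu t p) (at t)"
begin

section \<open>Homogeneous extension of the embedding, and its normal curvatures\<close>

definition proj :: "real^3 \<Rightarrow> real^3" where
  "proj x = inverse (norm x) *\<^sub>R x"

text \<open>Replaces the values of \<open>X t\<close> off the sphere by an extension that is
  constant along rays. Radial derivatives then vanish, and second derivatives compute accelerations
  along great circles.\<close>

definition Xh :: "real \<times> (real^3) \<Rightarrow> real^3" where
  "Xh y = X (fst y) (proj (snd y))"

definition dom :: "(real \<times> (real^3)) set" where
  "dom = {a<..<b} \<times> (- {0})"

lemma open_dom: "open dom"
  unfolding dom_def by (intro open_Times) auto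

lemma proj_S2: "x \<noteq> 0 \<Longrightarrow> proj x \<in> S2"
  by (simp add: proj_def)

lemma proj_scale: "r > 0 \<Longrightarrow> proj (r *\<^sub>R x) = proj x"
  by (simp add: proj_def)

lemma proj_id: "p \<in> S2 \<Longrightarrow> proj p = p"
  by (simp add: proj_def)

lemma Xh_Ck: "Ck k dom Xh"
proof -
  have snd: "Ck k dom (snd :: real \<times> (real^3) \<Rightarrow> real^3)" for k
    by (rule Ck_linear[OF open_dom bounded_linear_snd])
  have fst: "Ck k dom (fst :: real \<times> (real^3) \<Rightarrow> real)" for k
    by (rule Ck_linear[OF open_dom bounded_linear_fst])
  have "Ck k dom (\<lambda>y. inverse (norm (snd y)))"
    by (rule Ck_compose[OF open_dom _ _ snd Ck_inverse_norm, of "-{0}"]) (auto simp: dom_def)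
  then have 1: "Ck k dom (\<lambda>y. (fst y, proj (snd y)))"
    unfolding proj_def by (intro Ck_Pair Ck_scaleR fst snd open_dom)
  have o: "open ({a<..<b} \<times> U)" using smooth by (simp add: smooth_on_def)
  have "Ck k dom (\<lambda>y. (\<lambda>(t, x). X t x) (fst y, proj (snd y)))"
    by (rule Ck_compose[OF open_dom o _ 1 smooth_on_Ck[OF smooth]])
       (use S2U proj_S2 in \<open>auto simp: dom_def\<close>)
  then show ?thesis by (simp add: Xh_def[abs_def])
qed

lemma dx_Xh_Ck: "Ck k dom (dd v Xh)"
  by (rule Ck_dd[OF Xh_Ck])

lemma dx_linear:
  assumes "\<And>k. Ck k W f" "open W" "y \<in> W"
  shows "linear (\<lambda>w. dx w f y)"
proof -
  interpret bounded_linear "\<lambda>v. dd v f y" by (rule dd_linear[OF assms(2) assms(1) assms(3)])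
  show ?thesis by (rule linearI) (simp_all flip: add scaleR)
qed

lemmas dx_Xh_linear = dx_linear[OF Xh_Ck open_dom]

lemma dx_radial:
  assumes "(t, x) \<in> dom"
  shows "dx x Xh (t, x) = 0"
proof -
  have "((\<lambda>s. Xh ((t, x) + s *\<^sub>R (0, x))) has_vector_derivative dx x Xh (t, x)) (at 0)"
    using dd_line[OF open_dom Xh_Ck, of "(t, x)" 0 "(0, x)"] assms by simp
  moreover have "((\<lambda>s. Xh ((t, x) + s *\<^sub>R (0, x))) has_vector_derivative 0) (at 0)"
  proof (rule has_vector_derivative_transform_within_open[of "\<lambda>_. Xh (t, x)" _ _ "{-1<..<1}"])
    fix s :: real assume s: "s \<in> {-1<..<1}"
    have "x + s *\<^sub>R x = (1 + s) *\<^sub>R x" by (simp add: scaleR_add_left)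
    then have "proj (x + s *\<^sub>R x) = proj x" using s proj_scale[of "1 + s" x] by simp
    then show "Xh (t, x) = Xh ((t, x) + s *\<^sub>R (0, x))" by (simp add: Xh_def)
  qed auto
  ultimately show ?thesis using vector_derivative_unique_at by blast
qed

lemma dx_dx_radial:
  assumes "(t, x) \<in> dom"
  shows "dx x (dx u Xh) (t, x) = - dx u Xh (t, x)"
  using euler_dd[OF open_dom Xh_Ck, of 0 t x u] dx_radial assms by simp

text \<open>The curve is \<open>Xh\<close> along a circle of radius |x| starting at
  \<open>x\<close>, which is why \<open>w\<close> has the length of \<open>x\<close>. Its
  acceleration at 0 is the second derivative along \<open>w\<close> minus the radial derivative, and
  the latter is zero.\<close>

lemma great_circle_derivs:
  assumes x: "(t, x) \<in> dom" and w: "w \<bullet> x = 0" "norm w = norm x"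
  defines "c \<equiv> \<lambda>s. X t (gcirc (proj x) (proj w) s)"
  shows "(c has_vector_derivative dx w Xh (t, x)) (at 0)"
    "((\<lambda>s. vector_derivative c (at s)) has_vector_derivative dx w (dx w Xh) (t, x)) (at 0)"
proof -
  define g where "g s = cos s *\<^sub>R x + sin s *\<^sub>R w" for s
  have x0: "x \<noteq> 0" "w \<noteq> 0" using x w by (auto simp: dom_def)
  have ng: "norm (g s) = norm x" for s
  proof -
    have "norm (g s) ^ 2 = (cos s)\<^sup>2 * (norm x)\<^sup>2 + (sin s)\<^sup>2 * (norm w)\<^sup>2"
      unfolding g_def power2_norm_eq_inner using w(1)
      by (simp add: inner_add_left inner_add_right inner_commute power2_eq_square)
    also have "\<dots> = (norm x)\<^sup>2" unfolding w(2) by (simp flip: distrib_right)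
    finally show ?thesis by (simp add: power2_eq_iff_nonneg)
  qed
  have gd: "(t, g s) \<in> dom" for s using ng[of s] x0 x by (auto simp: dom_def)
  have c: "c = (\<lambda>s. Xh (t, g s))"
  proof
    fix s
    have "proj (g s) = gcirc (proj x) (proj w) s"
      unfolding proj_def ng gcirc_def w(2) by (simp add: g_def scaleR_add_right mult.commute)
    then show "c s = Xh (t, g s)" by (simp add: c_def Xh_def)
  qed
  have dg: "((\<lambda>s. f (t, g s)) has_vector_derivative - sin s *\<^sub>R dx x f (t, g s) + cos s *\<^sub>R dx w f (t, g s)) (at s)"
    if f: "\<And>k. Ck k dom f" for f :: "real \<times> (real^3) \<Rightarrow> real^3" and s
  proof -
    have "((\<lambda>s. (t, g s)) has_derivative (\<lambda>h. (0, h *\<^sub>R (- sin s *\<^sub>R x + cos s *\<^sub>R w)))) (at s)"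
      unfolding g_def by (auto intro!: derivative_eq_intros simp: algebra_simps)
    from has_derivative_compose[OF this dd_has_derivative[OF open_dom f gd]]
    show ?thesis
      unfolding has_vector_derivative_def
      using dx_linear[OF f open_dom gd, of s]
      by (simp add: linear_diff[OF dx_linear[OF f open_dom gd]] linear_cmul[OF dx_linear[OF f open_dom gd]])
  qed
  have c1: "(c has_vector_derivative - sin s *\<^sub>R dx x Xh (t, g s) + cos s *\<^sub>R dx w Xh (t, g s)) (at s)" for s
    unfolding c by (rule dg[OF Xh_Ck])
  have g0: "g 0 = x" by (simp add: g_def)
  show "(c has_vector_derivative dx w Xh (t, x)) (at 0)"
    using c1[of 0] by (simp add: g0)
  have "((\<lambda>s. - sin s *\<^sub>R dx x Xh (t, g s) + cos s *\<^sub>R dx w Xh (t, g s)) has_vector_derivative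
     (- sin 0 *\<^sub>R (- sin 0 *\<^sub>R dx x (dx x Xh) (t, g 0) + cos 0 *\<^sub>R dx w (dx x Xh) (t, g 0)) + (- cos 0) *\<^sub>R dx x Xh (t, g 0)) +
     (cos 0 *\<^sub>R (- sin 0 *\<^sub>R dx x (dx w Xh) (t, g 0) + cos 0 *\<^sub>R dx w (dx w Xh) (t, g 0)) + (- sin 0) *\<^sub>R dx w Xh (t, g 0))) (at 0)"
    by (intro has_vector_derivative_add has_vector_derivative_scaleR dg dx_Xh_Ck)
       (auto intro!: derivative_eq_intros)
  then show "((\<lambda>s. vector_derivative c (at s)) has_vector_derivative dx w (dx w Xh) (t, x)) (at 0)"
    using dx_radial[OF x] by (simp add: vector_derivative_at[OF c1] g0)
qed

lemma frechet_X:
  assumes t: "t \<in> {a<..<b}" and p: "p \<in> S2"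
  shows "(X t has_derivative frechet_derivative (X t) (at p)) (at p)"
proof -
  have o: "open ({a<..<b} \<times> U)" using smooth by (simp add: smooth_on_def)
  have "(t, p) \<in> {a<..<b} \<times> U" using t p S2U by auto
  from dd_has_derivative[OF o smooth_on_Ck[OF smooth] this]
  have "((\<lambda>y. (\<lambda>(t, x). X t x) (t, y)) has_derivative (\<lambda>v. dd (0, v) (\<lambda>(t, x). X t x) (t, p))) (at p)"
    by (rule has_derivative_compose[rotated]) (auto intro!: derivative_eq_intros)
  then show ?thesis by (auto simp: differentiable_def frechet_derivative_works[symmetric])
qed

lemma normal_curv_aux:
  assumes x: "(t, x) \<in> dom" and w: "w \<bullet> x = 0" "norm w = norm x"
  shows "normal_curv (X t) n (proj x) (proj w) = - (dx w (dx w Xh) (t, x) \<bullet> n (proj x)) / (norm (dx w Xh (t, x)))\<^sup>2"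
    and "frechet_derivative (X t) (at (proj x)) (proj w) = dx w Xh (t, x)"
proof -
  note d = great_circle_derivs[OF assms]
  show "normal_curv (X t) n (proj x) (proj w) = - (dx w (dx w Xh) (t, x) \<bullet> n (proj x)) / (norm (dx w Xh (t, x)))\<^sup>2"
    unfolding normal_curv_def Let_def vector_derivative_at[OF d(1)] vector_derivative_at[OF d(2)] ..
  let ?p = "proj x"
  have t: "t \<in> {a<..<b}" and p: "?p \<in> S2" using x proj_S2 by (auto simp: dom_def)
  have g: "(gcirc ?p (proj w) has_vector_derivative proj w) (at 0)"
    unfolding gcirc_def[abs_def] by (auto intro!: derivative_eq_intros)
  have g0: "gcirc ?p (proj w) 0 = ?p" by (simp add: gcirc_def)
  have "(X t has_derivative frechet_derivative (X t) (at ?p)) (at (gcirc ?p (proj w) 0))"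
    unfolding g0 by (rule frechet_X[OF t p])
  from vector_derivative_diff_chain_within[OF g has_derivative_at_withinI[OF this]]
  have "((\<lambda>s. X t (gcirc ?p (proj w) s)) has_vector_derivative frechet_derivative (X t) (at ?p) (proj w)) (at 0)"
    by (simp add: o_def)
  then show "frechet_derivative (X t) (at (proj x)) (proj w) = dx w Xh (t, x)"
    using d(1) vector_derivative_unique_at by blast
qed

text \<open>Rescaling \<open>w\<close> to the length of \<open>x\<close> makes the great circle
  formulas applicable; numerator and denominator both scale quadratically, so the quotient is
  unchanged.\<close>

lemma normal_curv_eq:
  assumes x: "(t, x) \<in> dom" and w: "w \<bullet> x = 0" "w \<noteq> 0"
  shows "proj w \<in> unit_tangents (proj x)"
    "normal_curv (X t) n (proj x) (proj w) = - (dx w (dx w Xh) (t, x) \<bullet> n (proj x)) / (norm (dx w Xh (t, x)))\<^sup>2"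
    "dx w Xh (t, x) = (norm w / norm x) *\<^sub>R frechet_derivative (X t) (at (proj x)) (proj w)"
    "dx w Xh (t, x) \<noteq> 0"
proof -
  have x0: "x \<noteq> 0" and t: "t \<in> {a<..<b}" using x by (auto simp: dom_def)
  show u: "proj w \<in> unit_tangents (proj x)"
    using w x0 by (simp add: unit_tangents_def proj_def)
  define r where "r = norm x / norm w"
  have r: "r > 0" using x0 w by (simp add: r_def)
  define v where "v = r *\<^sub>R w"
  have v: "v \<bullet> x = 0" "norm v = norm x" using w r by (simp_all add: v_def r_def)
  have pv: "proj v = proj w" using r by (simp add: v_def proj_scale)
  have lin: "dx v f (t, x) = r *\<^sub>R dx w f (t, x)" if "\<And>k. Ck k dom f" for f :: "real \<times> (real^3) \<Rightarrow> real^3"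
    unfolding v_def by (rule linear_cmul[OF dx_linear[OF that open_dom x]])
  have v1: "dx v Xh (t, x) = r *\<^sub>R dx w Xh (t, x)" by (rule lin[OF Xh_Ck])
  have "dx v (dx v Xh) (t, x) = r *\<^sub>R dx w (dx v Xh) (t, x)" by (rule lin[OF dx_Xh_Ck])
  also have "dx w (dx v Xh) (t, x) = dx v (dx w Xh) (t, x)" by (rule dd_commute[OF open_dom Xh_Ck x])
  also have "\<dots> = r *\<^sub>R dx w (dx w Xh) (t, x)" by (rule lin[OF dx_Xh_Ck])
  finally have v2: "dx v (dx v Xh) (t, x) = r *\<^sub>R r *\<^sub>R dx w (dx w Xh) (t, x)" .
  show "normal_curv (X t) n (proj x) (proj w) = - (dx w (dx w Xh) (t, x) \<bullet> n (proj x)) / (norm (dx w Xh (t, x)))\<^sup>2"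
    using normal_curv_aux(1)[OF x v] r unfolding pv v1 v2 by (simp add: power2_eq_square)
  show eq: "dx w Xh (t, x) = (norm w / norm x) *\<^sub>R frechet_derivative (X t) (at (proj x)) (proj w)"
    using normal_curv_aux(2)[OF x v] x0 w unfolding pv v1 by (simp add: r_def)
  have "frechet_derivative (X t) (at (proj x)) (proj w) \<noteq> 0"
    using embedded[OF t] u proj_S2[OF x0] unfolding embedded_sphere_def unit_tangents_def by fastforce
  then show "dx w Xh (t, x) \<noteq> 0" unfolding eq using w x0 by simp
qed

lemma tangential_split:
  fixes x w :: "real^3"
  assumes "x \<noteq> 0"
  obtains u r where "w = r *\<^sub>R x + u" "u \<bullet> x = 0"
  by (rule that[of "(w \<bullet> x) / (x \<bullet> x)" "w - ((w \<bullet> x) / (x \<bullet> x)) *\<^sub>R x"])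
     (use assms in \<open>simp_all add: inner_diff_left\<close>)

lemma nu_orthogonal:
  assumes x: "(t, x) \<in> dom"
  shows "dx w Xh (t, x) \<bullet> nu t (proj x) = 0"
proof -
  have x0: "x \<noteq> 0" and t: "t \<in> {a<..<b}" using x by (auto simp: dom_def)
  obtain u r where u: "w = r *\<^sub>R x + u" "u \<bullet> x = 0" using tangential_split[OF x0] by metis
  have lin: "linear (\<lambda>w. dx w Xh (t, x))" by (rule dx_Xh_linear[OF x])
  have "dx u Xh (t, x) \<bullet> nu t (proj x) = 0"
  proof (cases "u = 0")
    case True
    then show ?thesis using linear_0[OF lin] by simp
  next
    case False
    have "proj u \<bullet> proj x = 0" using u by (simp add: proj_def)
    then have "frechet_derivative (X t) (at (proj x)) (proj u) \<bullet> nu t (proj x) = 0"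
      using normal[OF t] proj_S2[OF x0] unfolding outer_unit_normal_def by blast
    then show ?thesis using normal_curv_eq(3)[OF x u(2) False] by simp
  qed
  then show ?thesis
    unfolding u(1) linear_add[OF lin] linear_cmul[OF lin] using dx_radial[OF x] by simp
qed

lemma norm_nu: "(t, x) \<in> dom \<Longrightarrow> norm (nu t (proj x)) = 1"
  using normal[of t] proj_S2[of x] unfolding outer_unit_normal_def dom_def by blast

lemma time_derivative:
  assumes x: "(t, x) \<in> dom"
  shows "dd (1, 0) Xh (t, x) = ((lam1 (X t) (nu t) (proj x) + lam2 (X t) (nu t) (proj x))
     / (lam1 (X t) (nu t) (proj x) * lam2 (X t) (nu t) (proj x))) *\<^sub>R nu t (proj x)"
proof -
  have "((\<lambda>s. Xh ((0, x) + s *\<^sub>R (1, 0))) has_vector_derivative dd (1, 0) Xh (t, x)) (at t)"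
    using dd_line[OF open_dom Xh_Ck, of "(0, x)" t "(1, 0)"] x by simp
  then have "((\<lambda>s. X s (proj x)) has_vector_derivative dd (1, 0) Xh (t, x)) (at t)"
    by (simp add: Xh_def)
  with flow[of t "proj x"] show ?thesis
    using x proj_S2 vector_derivative_unique_at unfolding dom_def by blast
qed

text \<open>Positivity of the infimum \<open>lam2\<close> passes to each single direction once the
  normal curvatures are bounded below, which follows from their continuity on the compact circle of
  unit tangents.\<close>

lemma dx_dx_neg:
  assumes x: "(t, x) \<in> dom" and w: "w \<bullet> x = 0" "w \<noteq> 0"
  shows "dx w (dx w Xh) (t, x) \<bullet> nu t (proj x) < 0"
proof -
  let ?p = "proj x"
  have x0: "x \<noteq> 0" and t: "t \<in> {a<..<b}" using x by (auto simp: dom_def)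
  have pd: "(t, ?p) \<in> dom" using proj_S2[OF x0] t by (auto simp: dom_def)
  have pp: "proj ?p = ?p" using proj_S2[OF x0] by (rule proj_id)
  have pu: "proj u = u" if "u \<in> unit_tangents ?p" for u using that by (simp add: unit_tangents_def proj_def)
  define q where "q u = - (dx u (dx u Xh) (t, ?p) \<bullet> nu t ?p) / (norm (dx u Xh (t, ?p)))\<^sup>2" for u
  have qu: "normal_curv (X t) (nu t) ?p u = q u" and q0: "dx u Xh (t, ?p) \<noteq> 0" if u: "u \<in> unit_tangents ?p" for u
  proof -
    have "u \<bullet> ?p = 0" "u \<noteq> 0" using u by (auto simp: unit_tangents_def)
    from normal_curv_eq(2,4)[OF pd this]
    show "normal_curv (X t) (nu t) ?p u = q u" "dx u Xh (t, ?p) \<noteq> 0"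
      unfolding pp pu[OF u] by (simp_all add: q_def)
  qed
  \<comment> \<open>In coordinates the second derivative is a quadratic polynomial in
    \<open>u\<close>, hence continuous in the direction.\<close>
  have quad: "dx u (dx u Xh) (t, ?p) = (\<Sum>i\<in>Basis. ((0, u) \<bullet> i) *\<^sub>R (\<Sum>j\<in>Basis. ((0, u) \<bullet> j) *\<^sub>R dd j (dd i Xh) (t, ?p)))" for u
  proof -
    have "dd i (dx u Xh) (t, ?p) = (\<Sum>j\<in>Basis. ((0, u) \<bullet> j) *\<^sub>R dd j (dd i Xh) (t, ?p))" for i
      by (rule trans[OF dd_commute[OF open_dom Xh_Ck pd] dd_expand[OF open_dom dx_Xh_Ck pd]])
    then show ?thesis
      by (intro trans[OF dd_expand[OF open_dom dx_Xh_Ck pd]] sum.cong refl) simp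
  qed
  have lin: "dx u Xh (t, ?p) = (\<Sum>i\<in>Basis. ((0, u) \<bullet> i) *\<^sub>R dd i Xh (t, ?p))" for u
    by (rule dd_expand[OF open_dom Xh_Ck pd])
  have cont: "continuous_on (unit_tangents ?p) q"
    unfolding q_def
  proof (intro continuous_intros)
    show "continuous_on (unit_tangents ?p) (\<lambda>u. dx u (dx u Xh) (t, ?p))"
      unfolding quad by (intro continuous_intros)
    show "continuous_on (unit_tangents ?p) (\<lambda>u. dx u Xh (t, ?p))"
      unfolding lin by (intro continuous_intros)
  qed (simp add: q0)
  have "compact (unit_tangents ?p)"
  proof -
    have "unit_tangents ?p = sphere 0 1 \<inter> {u. ?p \<bullet> u = 0}"
      by (auto simp: unit_tangents_def inner_commute)
    then show ?thesis by (simp add: compact_Int_closed closed_hyperplane)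
  qed
  then have "bounded (q ` unit_tangents ?p)"
    using cont by (intro compact_imp_bounded compact_continuous_image)
  then have "bdd_below (normal_curv (X t) (nu t) ?p ` unit_tangents ?p)"
    using qu by (metis (no_types, lifting) bounded_imp_bdd_below image_cong)
  then have "lam2 (X t) (nu t) ?p \<le> normal_curv (X t) (nu t) ?p (proj w)"
    unfolding lam2_def by (rule cINF_lower) (rule normal_curv_eq(1)[OF x w])
  then have "normal_curv (X t) (nu t) ?p (proj w) > 0"
    using convex[OF t proj_S2[OF x0]] by linarith
  then show ?thesis
    unfolding normal_curv_eq(2)[OF x w] using normal_curv_eq(4)[OF x w]
    by (simp add: divide_less_0_iff)
qed

end

text \<open>The inverse function theorem yields a differentiable inverse, and
  \<open>Ck_local_inverse\<close> raises it to all orders. The last two conclusions say that the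
  derivatives of \<open>f\<close> and \<open>g\<close> are inverse to each other.\<close>

lemma smooth_local_inverse:
  fixes f :: "'a::euclidean_space \<Rightarrow> 'a"
  assumes S: "open S" and f: "\<And>k. Ck k S f" and x0: "x0 \<in> S" and inj: "inj (\<lambda>v. dd v f x0)"
  obtains T V g where "open T" "T \<subseteq> S" "x0 \<in> T" "open V" "f x0 \<in> V" "homeomorphism T V f g"
    "\<And>k. Ck k V g" "\<And>y v. y \<in> V \<Longrightarrow> dd (dd v g y) f (g y) = v" "\<And>y v. y \<in> V \<Longrightarrow> dd (dd v f (g y)) g y = v"
proof -
  define f' where "f' y = Blinfun (\<lambda>v. dd v f y)" for y
  have f': "blinfun_apply (f' y) = (\<lambda>v. dd v f y)" if "y \<in> S" for y
    unfolding f'_def by (rule bounded_linear_Blinfun_apply[OF dd_linear[OF S f that]])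
  have "linear (\<lambda>v. dd v f x0)" using dd_linear[OF S f x0] by (rule bounded_linear.linear)
  then obtain B where B: "linear B" "\<And>v. B (dd v f x0) = v"
    using linear_injective_isomorphism[OF _ inj] by blast
  have "Blinfun B o\<^sub>L f' x0 = id_blinfun"
    by (rule blinfun_eqI) (simp add: f'[OF x0] bounded_linear_Blinfun_apply linear_conv_bounded_linear[THEN iffD1, OF B(1)] B(2))
  \<comment> \<open>Continuity in operator norm reduces to basis directions because the space is
    finite-dimensional.\<close>
  moreover have "continuous_on S f'"
  proof (rule continuous_on_blinfun_componentwise)
    fix i :: 'a
    have "continuous_on S (dd i f)" by (rule Ck_continuous[OF Ck_dd[OF f]])
    then show "continuous_on S (\<lambda>x. blinfun_apply (f' x) i)"
      by (rule continuous_on_eq) (simp add: f')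
  qed
  moreover have "(f has_derivative blinfun_apply (f' y)) (at y)" if "y \<in> S" for y
    unfolding f'[OF that] by (rule dd_has_derivative[OF S f that])
  ultimately obtain T V g g' where *: "open T" "T \<subseteq> S" "x0 \<in> T" "open V" "f x0 \<in> V" "homeomorphism T V f g"
    "\<And>y. y \<in> V \<Longrightarrow> (g has_derivative g' y) (at y)"
    "\<And>y. y \<in> V \<Longrightarrow> g' y = inv (blinfun_apply (f' (g y)))"
    "\<And>y. y \<in> V \<Longrightarrow> bij (blinfun_apply (f' (g y)))"
    using inverse_function_theorem[OF S _ _ x0, of f f' "Blinfun B"] by metis
  have gS: "g y \<in> S" if "y \<in> V" for y using *(2,6) that unfolding homeomorphism_def by blast
  have fg: "f (g y) = y" if "y \<in> V" for y using *(6) that unfolding homeomorphism_def by blast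
  have bij: "bij (\<lambda>v. dd v f (g y))" if "y \<in> V" for y using *(9)[OF that] f'[OF gS[OF that]] by simp
  have gCk: "Ck k V g" for k
    by (rule Ck_local_inverse[OF S *(4) f _ fg *(7)]) (use gS bij bij_is_inj in auto)
  have dg: "dd v g y = inv (\<lambda>v. dd v f (g y)) v" if "y \<in> V" for v y
    using dd_eqI[OF *(7)[OF that]] *(8)[OF that] f'[OF gS[OF that]] by simp
  show ?thesis
  proof (rule that[OF *(1-6) gCk])
    show "dd (dd v g y) f (g y) = v" if "y \<in> V" for y v
      unfolding dg[OF that] by (rule surj_f_inv_f[OF bij_is_surj[OF bij[OF that]]])
    show "dd (dd v f (g y)) g y = v" if "y \<in> V" for y v
      unfolding dg[OF that] by (rule inv_f_f[OF bij_is_inj[OF bij[OF that]]])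
  qed
qed

section \<open>A smooth normal field near a given point\<close>

lemma bounded_bilinear_cross3: "bounded_bilinear cross3"
  using bilinear_cross bilinear_conv_bounded_bilinear by blast

text \<open>The expansion n x (a x b) = (n . b) a - (n . a) b vanishes, so \<open>n\<close> is
  collinear with \<open>cross3 a b\<close>.\<close>

lemma orthogonal_cross3_parallel:
  fixes n a b :: "real^3"
  assumes "n \<bullet> a = 0" "n \<bullet> b = 0" "cross3 a b \<noteq> 0"
  shows "\<exists>k. n = k *\<^sub>R cross3 a b"
proof -
  have "cross3 n (cross3 a b) = 0"
    using Lagrange[of n a b] assms by simp
  then have "collinear {0, cross3 a b, n}"
    unfolding cross_eq_0 by (simp add: insert_commute)
  then show ?thesis using assms(3) unfolding collinear_lemma by auto
qed

context convex_flow
begin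

definition speed :: "real \<Rightarrow> real^3 \<Rightarrow> real" where
  "speed t p = (lam1 (X t) (nu t) p + lam2 (X t) (nu t) p) / (lam1 (X t) (nu t) p * lam2 (X t) (nu t) p)"

definition pinch :: "real \<Rightarrow> real^3 \<Rightarrow> real" where
  "pinch t p = (lam1 (X t) (nu t) p - lam2 (X t) (nu t) p)\<^sup>2
     / (4 * (lam1 (X t) (nu t) p)\<^sup>2 * (lam2 (X t) (nu t) p)\<^sup>2)"

text \<open>Convexity makes the derivative of this multiple of the normal injective on tangent vectors;
  being homogeneous of degree -2, it is a local diffeomorphism in the radial direction as well.\<close>

lemma local_normal_field:
  assumes x0: "(t0, p0) \<in> dom" and p0: "p0 \<in> S2"
  obtains N :: "real \<times> (real^3) \<Rightarrow> real^3" and D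
  where "open D" "D \<subseteq> dom" "(t0, p0) \<in> D" "\<And>k. Ck k D N" "N (t0, p0) = nu t0 p0"
    "\<And>t x. (t, x) \<in> D \<Longrightarrow> dx x N (t, x) = -2 *\<^sub>R N (t, x)"
    "\<And>t x w. (t, x) \<in> D \<Longrightarrow> dx w Xh (t, x) \<bullet> N (t, x) = 0"
    "\<And>t x. (t, x) \<in> D \<Longrightarrow> N (t, x) \<noteq> 0 \<Longrightarrow> \<exists>k. nu t (proj x) = k *\<^sub>R N (t, x)"
proof -
  have pp: "p0 \<noteq> 0" "p0 \<bullet> p0 = 1" using p0 by (auto simp: dot_square_norm)
  have pj: "proj p0 = p0" by (rule proj_id[OF p0])
  obtain u0 v0 where uv: "norm u0 = 1" "norm v0 = 1" "u0 \<bullet> v0 = 0" "u0 \<bullet> p0 = 0" "v0 \<bullet> p0 = 0"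
    using exists_orthonormal_pair[OF pp(1)] by blast
  \<comment> \<open>Derivatives of \<open>Xh\<close> in two fixed directions are smooth and tangent
    to the surface, so their cross product is a smooth normal field. Each factor has degree -1,
    whence the degree -2.\<close>
  define N0 where "N0 y = cross3 (dx u0 Xh y) (dx v0 Xh y)" for y
  have N0: "Ck k dom N0" for k
    unfolding N0_def by (rule Ck_bilinear[OF open_dom bounded_bilinear_cross3 dx_Xh_Ck dx_Xh_Ck])
  have lin: "linear (\<lambda>w. dx w Xh y)" if "y \<in> dom" for y by (rule dx_Xh_linear[OF that])
  have N0nz: "N0 (t0, p0) \<noteq> 0"
  proof
    assume "N0 (t0, p0) = 0"
    then have "collinear {0, dx u0 Xh (t0, p0), dx v0 Xh (t0, p0)}"
      unfolding N0_def cross_eq_0 .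
    then obtain c where c: "dx v0 Xh (t0, p0) = c *\<^sub>R dx u0 Xh (t0, p0)"
    proof -
      have "dx u0 Xh (t0, p0) \<noteq> 0" using normal_curv_eq(4)[OF x0 uv(4)] uv(1) by force
      then show ?thesis
        using that[of 0] that \<open>collinear _\<close> unfolding collinear_lemma by auto
    qed
    have "dx (v0 - c *\<^sub>R u0) Xh (t0, p0) = 0"
      using c by (simp add: linear_diff[OF lin[OF x0]] linear_cmul[OF lin[OF x0]])
    moreover have "(v0 - c *\<^sub>R u0) \<bullet> p0 = 0" using uv by (simp add: inner_diff_left)
    ultimately have "v0 - c *\<^sub>R u0 = 0" using normal_curv_eq(4)[OF x0] by blast
    then have "v0 \<bullet> v0 = c * (u0 \<bullet> v0)" by (metis eq_iff_diff_eq_0 inner_scaleR_left)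
    then show False using uv by (simp add: dot_square_norm)
  qed
  have par: "\<exists>k. nu t (proj x) = k *\<^sub>R N0 (t, x)" if "(t, x) \<in> dom" "N0 (t, x) \<noteq> 0" for t x
    using orthogonal_cross3_parallel[of "nu t (proj x)" "dx u0 Xh (t, x)" "dx v0 Xh (t, x)"]
      nu_orthogonal[OF that(1)] that(2) by (simp add: N0_def inner_commute)
  obtain \<kappa> where \<kappa>: "nu t0 p0 = \<kappa> *\<^sub>R N0 (t0, p0)"
    using par[OF x0 N0nz] pj by auto
  have k0: "\<kappa> \<noteq> 0" using norm_nu[OF x0] \<kappa> pj by auto
  define N where "N y = \<kappa> *\<^sub>R N0 y" for y
  \<comment> \<open>On this half-space \<open>x\<close>, \<open>u0\<close>, \<open>v0\<close> still
    span three-space, so being orthogonal to the derivatives along \<open>u0\<close> and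
    \<open>v0\<close> implies being orthogonal to all spatial derivatives of
    \<open>Xh\<close>.\<close>
  define D where "D = dom \<inter> {y. snd y \<bullet> p0 > 0}"
  have oD: "open D"
    unfolding D_def by (intro open_Int open_dom open_Collect_less continuous_intros)
  show ?thesis
  proof (rule that[of D N])
    show "open D" by (rule oD)
    show "D \<subseteq> dom" by (auto simp: D_def)
    show "(t0, p0) \<in> D" using x0 pp by (simp add: D_def)
    show "N (t0, p0) = nu t0 p0" using \<kappa> by (simp add: N_def)
    have NCk: "Ck k dom N" for k unfolding N_def by (intro Ck_scaleR Ck_const open_dom N0)
    show "Ck k D N" for k by (rule Ck_subset[OF NCk]) (auto simp: D_def)
  next
    fix t x assume "(t, x) \<in> D"
    then have y: "(t, x) \<in> dom" and xp: "x \<bullet> p0 > 0" by (auto simp: D_def)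
    have "dx x N0 (t, x) = -2 *\<^sub>R N0 (t, x)"
      unfolding N0_def dd_bilinear[OF open_dom bounded_bilinear_cross3 dx_Xh_Ck dx_Xh_Ck y] dx_dx_radial[OF y]
      by (simp add: bounded_bilinear.minus_left[OF bounded_bilinear_cross3]
        bounded_bilinear.minus_right[OF bounded_bilinear_cross3] scaleR_2)
    then show "dx x N (t, x) = -2 *\<^sub>R N (t, x)"
      unfolding N_def using dd_linear_compose[OF open_dom N0 y bounded_linear_scaleR_right[of \<kappa>], of "(0, x)"] by simp
  next
    fix t x w assume "(t, x) \<in> D"
    then have y: "(t, x) \<in> dom" and xp: "x \<bullet> p0 > 0" by (auto simp: D_def)
    have p0n: "norm p0 = 1" using p0 by simp
    have exp: "v = (v \<bullet> u0) *\<^sub>R u0 + (v \<bullet> v0) *\<^sub>R v0 + (v \<bullet> p0) *\<^sub>R p0" for v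
      by (rule orthonormal_triple_expand) (use uv p0n in auto)
    define r where "r = (w \<bullet> p0) / (x \<bullet> p0)"
    have "(w - r *\<^sub>R x) \<bullet> p0 = 0" using xp by (simp add: r_def inner_diff_left)
    then obtain \<alpha> \<beta> where "w - r *\<^sub>R x = \<alpha> *\<^sub>R u0 + \<beta> *\<^sub>R v0"
      using exp[of "w - r *\<^sub>R x"] by auto
    then have "w = r *\<^sub>R x + \<alpha> *\<^sub>R u0 + \<beta> *\<^sub>R v0" by (simp add: algebra_simps)
    then have "dx w Xh (t, x) = \<alpha> *\<^sub>R dx u0 Xh (t, x) + \<beta> *\<^sub>R dx v0 Xh (t, x)"
      using dx_radial[OF y] by (simp add: linear_add[OF lin[OF y]] linear_cmul[OF lin[OF y]])
    then show "dx w Xh (t, x) \<bullet> N (t, x) = 0"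
      by (simp add: N_def N0_def inner_add_left dot_cross_self)
  next
    fix t x assume "(t, x) \<in> D" and n: "N (t, x) \<noteq> 0"
    then have "(t, x) \<in> dom" "N0 (t, x) \<noteq> 0" by (auto simp: D_def N_def)
    from par[OF this] obtain k where "nu t (proj x) = k *\<^sub>R N0 (t, x)" by blast
    then have "nu t (proj x) = (k / \<kappa>) *\<^sub>R N (t, x)" using k0 by (simp add: N_def)
    then show "\<exists>k. nu t (proj x) = k *\<^sub>R N (t, x)" by blast
  qed
qed

end

subsection \<open>Reduction to the support function\<close>

context convex_flow
begin

text \<open>\<open>Y (t, z)\<close> is the surface point with outer normal along \<open>z\<close>,
  and \<open>H\<close> is its inner product with \<open>z\<close>. Since variations of
  \<open>Y\<close> are tangential, \<open>Y\<close> is the spatial gradient of \<open>H\<close> and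
  its derivative is the Hessian, the inverse of the Weingarten map up to the factor |z|.\<close>

lemma local_representation:
  assumes y0: "(t0, p0) \<in> dom" and p0: "p0 \<in> S2"
  obtains z0 :: "real^3" and W H and Y :: "real \<times> (real^3) \<Rightarrow> real^3"
  where "norm z0 = 1" "open W" "(t0, z0) \<in> W" "\<And>k. Ck k W (H :: real \<times> (real^3) \<Rightarrow> real)"    "\<And>t z. (t, z) \<in> W \<Longrightarrow> degenerate_form (\<lambda>w. dx w Y (t, z)) z"
    "\<And>t z v w. (t, z) \<in> W \<Longrightarrow> dx v (dx w H) (t, z) = dx v Y (t, z) \<bullet> w"
    "\<And>t z. (t, z) \<in> W \<Longrightarrow> dd (1, 0) H (t, z) = (z \<bullet> z) * degenerate_form.tr (\<lambda>w. dx w Y (t, z))"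
    "\<And>t z. (t, z) \<in> W \<Longrightarrow> \<exists>p\<in>S2. t \<in> {a<..<b} \<and> pinch t p = (norm z)\<^sup>2 * degenerate_form.disc (\<lambda>w. dx w Y (t, z)) / 4"
    "pinch t0 p0 = degenerate_form.disc (\<lambda>w. dx w Y (t0, z0)) / 4"
    "continuous (at (t0, p0) within {a<..<b} \<times> S2) (\<lambda>y. pinch (fst y) (snd y))"
proof -
  obtain N :: "real \<times> (real^3) \<Rightarrow> real^3" and D where oD: "open D" and Ddom: "D \<subseteq> dom" and y0D: "(t0, p0) \<in> D"
    and NCk: "\<And>k. Ck k D N" and N0: "N (t0, p0) = nu t0 p0"
    and Nrad: "\<And>t x. (t, x) \<in> D \<Longrightarrow> dx x N (t, x) = -2 *\<^sub>R N (t, x)"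
    and Northo: "\<And>t x w. (t, x) \<in> D \<Longrightarrow> dx w Xh (t, x) \<bullet> N (t, x) = 0"
    and Npar: "\<And>t x. (t, x) \<in> D \<Longrightarrow> N (t, x) \<noteq> 0 \<Longrightarrow> \<exists>k. nu t (proj x) = k *\<^sub>R N (t, x)"
    using local_normal_field[OF assms] by metis
  have XCk: "Ck k D Xh" for k by (rule Ck_subset[OF Xh_Ck Ddom])
  have dXCk: "Ck k D (dd v Xh)" for k v by (rule Ck_dd[OF XCk])
  have Xlin: "linear (\<lambda>w. dx w Xh y)" if "y \<in> D" for y by (rule dx_linear[OF XCk oD that])
  have Nlin: "linear (\<lambda>w. dx w N y)" if "y \<in> D" for y by (rule dx_linear[OF NCk oD that])
  have weingarten: "dx u Xh y \<bullet> dx u N y = - (dx u (dx u Xh) y \<bullet> N y)" if y: "y \<in> D" for u y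
  proof -
    have "dx u (\<lambda>y. dx u Xh y \<bullet> N y) y = dx u (\<lambda>_. 0 :: real) y"
      by (rule dd_cong[OF oD y]) (use Northo in auto)
    also have "\<dots> = 0" by (rule dd_eqI[OF has_derivative_const])
    finally show ?thesis unfolding dd_inner[OF oD dXCk NCk y] by simp
  qed
  have ne: "x \<noteq> 0" if "(t, x) \<in> D" for t x using that Ddom by (auto simp: dom_def)
  have pj: "proj p0 = p0" by (rule proj_id[OF p0])
  have pos0: "dx u Xh (t0, p0) \<bullet> dx u N (t0, p0) > 0" if "u \<bullet> p0 = 0" "u \<noteq> 0" for u
    using dx_dx_neg[OF y0 that] unfolding weingarten[OF y0D] N0 pj by simp

  \<comment> \<open>Time is carried along as a coordinate, so that a single inversion is smooth
    jointly in time and normal direction.\<close>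
  define \<Phi> where "\<Phi> y = (fst y, N y)" for y
  have PCk: "Ck k D \<Phi>" for k
    unfolding \<Phi>_def by (intro Ck_Pair oD NCk Ck_linear bounded_linear_fst)
  have dP: "dd v \<Phi> y = (fst v, dd v N y)" if y: "y \<in> D" for v y
    unfolding \<Phi>_def
    by (rule dd_eqI) (intro has_derivative_Pair bounded_linear_imp_has_derivative bounded_linear_fst dd_has_derivative[OF oD NCk y])
  have "inj (\<lambda>v. dd v \<Phi> (t0, p0))"
  proof -
    have "v = 0" if v: "dd v \<Phi> (t0, p0) = 0" for v
    proof -
      obtain w where w: "v = (0, w)" "dx w N (t0, p0) = 0"
        using v unfolding dP[OF y0D] by (cases v) (auto simp: zero_prod_def)
      obtain r u where u: "w = r *\<^sub>R p0 + u" "u \<bullet> p0 = 0" using tangential_split[OF ne[OF y0D]] by metis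
      have 1: "r *\<^sub>R (-2 *\<^sub>R N (t0, p0)) + dx u N (t0, p0) = 0"
        using w(2) Nrad[OF y0D] unfolding u(1) linear_add[OF Nlin[OF y0D]] linear_cmul[OF Nlin[OF y0D]] by simp
      \<comment> \<open>Pairing with the tangent vector \<open>dx u Xh\<close> removes the radial
        multiple of \<open>N\<close> and leaves the pairing that convexity makes strictly
        positive.\<close>
      have u0: "u = 0"
      proof (rule ccontr)
        assume "u \<noteq> 0"
        have "dx u Xh (t0, p0) \<bullet> (r *\<^sub>R (-2 *\<^sub>R N (t0, p0)) + dx u N (t0, p0)) = 0" unfolding 1 by simp
        then show False using pos0[OF u(2) \<open>u \<noteq> 0\<close>] Northo[OF y0D, of u] by (simp add: inner_add_right inner_diff_right)
      qed
      have "r *\<^sub>R (-2 *\<^sub>R N (t0, p0)) = 0" using 1 linear_0[OF Nlin[OF y0D]] by (simp add: u0)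
      moreover have "norm (N (t0, p0)) = 1" using norm_nu[OF y0] pj N0 by simp
      ultimately have "r = 0" by auto
      then show ?thesis using u(1) u0 w(1) by (simp add: zero_prod_def)
    qed
    then show ?thesis
      by (subst linear_injective_0[OF bounded_linear.linear[OF dd_linear[OF oD PCk y0D]]]) blast
  qed
  then obtain T V g where T: "open T" "T \<subseteq> D" "(t0, p0) \<in> T" and V: "open V" "\<Phi> (t0, p0) \<in> V"
    and hom: "homeomorphism T V \<Phi> g" and gCk: "\<And>k. Ck k V g"
    and dPg: "\<And>y v. y \<in> V \<Longrightarrow> dd (dd v g y) \<Phi> (g y) = v"
    and dgP: "\<And>y v. y \<in> V \<Longrightarrow> dd (dd v \<Phi> (g y)) g y = v"
    using smooth_local_inverse[OF oD PCk y0D] by metis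
  have gT: "g y \<in> T" and gD: "g y \<in> D" and Pg: "\<Phi> (g y) = y" if "y \<in> V" for y
    using hom that T(2) unfolding homeomorphism_def by blast+
  have gP: "g (\<Phi> y) = y" if "y \<in> T" for y using hom that unfolding homeomorphism_def by blast
  define z0 where "z0 = nu t0 p0"
  have P0: "\<Phi> (t0, p0) = (t0, z0)" by (simp add: \<Phi>_def z0_def N0)
  define G where "G y = snd (g y)" for y
  have gG: "g (t, z) = (t, G (t, z))" and NG: "N (t, G (t, z)) = z" and GD: "(t, G (t, z)) \<in> D" if "(t, z) \<in> V" for t z
  proof -
    have "fst (g (t, z)) = t" "N (g (t, z)) = z" using Pg[OF that] by (auto simp: \<Phi>_def)
    then show "g (t, z) = (t, G (t, z))" by (simp add: G_def prod_eq_iff)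
    then show "N (t, G (t, z)) = z" "(t, G (t, z)) \<in> D" using \<open>N (g (t, z)) = z\<close> gD[OF that] by simp_all
  qed
  have G0: "G (t0, z0) = p0" using gP[OF T(3)] by (simp add: G_def P0)
  have fst_dg: "fst (dd v g y) = fst v" if "y \<in> V" for v y
    using dPg[OF that, of v] unfolding dP[OF gD[OF that]] by (metis fst_conv)

  define Y where "Y y = Xh (g y)" for y
  have YCk: "Ck k V Y" for k
    unfolding Y_def by (rule Ck_compose[OF V(1) oD _ gCk XCk]) (use gD in auto)
  have dY: "dd v Y y = dd (dd v g y) Xh (g y)" if "y \<in> V" for v y
    unfolding Y_def by (rule dd_eqI[OF dd_compose[OF V(1) oD gCk XCk that gD[OF that]]])
  have dYN: "dx (dx u N (t, G (t, z))) Y (t, z) = dx u Xh (t, G (t, z))" if y: "(t, z) \<in> V" for t z u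
  proof -
    have "dx (dx u N (t, G (t, z))) g (t, z) = (0, u)"
      using dgP[OF y, of "(0, u)"] unfolding dP[OF gD[OF y]] by (simp add: gG[OF y])
    then show ?thesis using dY[OF y] by (simp add: gG[OF y])
  qed
  \<comment> \<open>A variation \<open>w\<close> of the normal consists of a rescaling of
    \<open>z\<close>, which leaves the position unchanged, and the image of a tangent vector
    \<open>u\<close>, which alone contributes to the derivative of \<open>Y\<close>.\<close>
  have split: "\<exists>u. u \<bullet> G (t, z) = 0 \<and> dx w Y (t, z) = dx u Xh (t, G (t, z))
      \<and> dx w Y (t, z) \<bullet> w = dx u Xh (t, G (t, z)) \<bullet> dx u N (t, G (t, z)) \<and> (u = 0 \<longrightarrow> (\<exists>r. w = r *\<^sub>R z))"
    if y: "(t, z) \<in> V" for t z w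
  proof -
    let ?y = "(t, G (t, z))"
    obtain u' where u': "dx w g (t, z) = (0, u')" using fst_dg[OF y, of "(0, w)"] by (cases "dx w g (t, z)") auto
    obtain r u where u: "u' = r *\<^sub>R G (t, z) + u" "u \<bullet> G (t, z) = 0" using tangential_split[OF ne[OF GD[OF y]]] by metis
    have "dx u' N ?y = w" using dPg[OF y, of "(0, w)"] unfolding dP[OF gD[OF y]] u' by (simp add: gG[OF y])
    then have w: "w = r *\<^sub>R (-2 *\<^sub>R z) + dx u N ?y"
      using Nrad[OF GD[OF y]] NG[OF y]
      unfolding u(1) linear_add[OF Nlin[OF GD[OF y]]] linear_cmul[OF Nlin[OF GD[OF y]]] by simp
    have "dx w Y (t, z) = dx u' Xh ?y" using dY[OF y, of "(0, w)"] unfolding u' by (simp add: gG[OF y])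
    also have "\<dots> = dx u Xh ?y"
      using dx_radial GD[OF y] Ddom
      unfolding u(1) linear_add[OF Xlin[OF GD[OF y]]] linear_cmul[OF Xlin[OF GD[OF y]]] by auto
    finally have A: "dx w Y (t, z) = dx u Xh ?y" .
    have "dx u Xh ?y \<bullet> z = 0" using Northo[OF GD[OF y], of u] NG[OF y] by simp
    then have "dx w Y (t, z) \<bullet> w = dx u Xh ?y \<bullet> dx u N ?y"
      unfolding A by (subst w) (simp add: inner_add_right inner_diff_right)
    moreover have "\<exists>r. w = r *\<^sub>R z" if "u = 0"
    proof -
      have "w = (r * (-2)) *\<^sub>R z"
        using w that linear_0[OF Nlin[OF GD[OF y]]] by (simp only: scaleR_scaleR add_0_right)
      then show ?thesis by blast
    qed
    ultimately show ?thesis using A u(2) by blast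
  qed

  obtain u0 :: "real^3" where u0: "norm u0 = 1" "u0 \<bullet> p0 = 0"
    using exists_orthonormal_pair[OF ne[OF y0D]] by blast
  define w0 where "w0 = dx u0 N (t0, p0)"
  \<comment> \<open>Away from the base point \<open>nu\<close> could a priori be a negative multiple
    of \<open>z\<close>. On \<open>W\<close> some second derivative of \<open>Xh\<close> in a
    tangent direction is negative against \<open>z\<close>; convexity makes it negative against
    \<open>nu\<close> too, so the multiple is positive.\<close>
  define W where "W = V \<inter> {y. dx w0 Y y \<bullet> w0 > 0}"
  have oW: "open W"
  proof -
    have "continuous_on V (\<lambda>y. dx w0 Y y \<bullet> w0)"
      by (intro continuous_intros Ck_continuous[OF Ck_dd[OF YCk]])
    then have "open (V \<inter> (\<lambda>y. dx w0 Y y \<bullet> w0) -` {0<..})"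
      by (rule continuous_open_preimage[OF _ V(1) open_greaterThan])
    then show ?thesis unfolding W_def vimage_def by simp
  qed
  have WV: "W \<subseteq> V" by (auto simp: W_def)
  have z0V: "(t0, z0) \<in> V" using V(2) P0 by simp
  have z0W: "(t0, z0) \<in> W"
  proof -
    have "u0 \<noteq> 0" using u0 by auto
    then show ?thesis
      using dYN[OF z0V, of u0] pos0[OF u0(2)] z0V unfolding G0 W_def w0_def by simp
  qed

  define H where "H y = Y y \<bullet> snd y" for y
  have sndCk: "Ck k V (snd :: real \<times> (real^3) \<Rightarrow> real^3)" for k by (rule Ck_linear[OF V(1) bounded_linear_snd])
  have HCk: "Ck k V H" for k
    unfolding H_def by (rule Ck_inner[OF V(1) YCk sndCk])
  have Yz: "dx w Y (t, z) \<bullet> z = 0" if y: "(t, z) \<in> V" for t z w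
  proof -
    obtain u where "dx w Y (t, z) = dx u Xh (t, G (t, z))" using split[OF y] by blast
    then show ?thesis using Northo[OF GD[OF y], of u] NG[OF y] by simp
  qed
  have dH: "dd v H y = Y y \<bullet> snd v + dd v Y y \<bullet> snd y" if y: "y \<in> V" for v y
  proof -
    have "dd v snd y = snd v" by (rule dd_eqI[OF bounded_linear_imp_has_derivative[OF bounded_linear_snd]])
    then show ?thesis unfolding H_def dd_inner[OF V(1) YCk sndCk y] by simp
  qed
  have ddH: "dx v (dx w H) y = dx v Y y \<bullet> w" if y: "y \<in> V" for v w y
  proof -
    have "dx v (dx w H) y = dx v (\<lambda>y. Y y \<bullet> w) y"
      by (rule dd_cong[OF V(1) y]) (use dH Yz in auto)
    also have "\<dots> = dx v Y y \<bullet> w"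
      by (rule dd_linear_compose[OF V(1) YCk y bounded_linear_inner_left])
    finally show ?thesis .
  qed
  have deg: "degenerate_form (\<lambda>w. dx w Y (t, z)) z" and nuz: "nu t (proj (G (t, z))) = (1 / norm z) *\<^sub>R z" if y: "(t, z) \<in> W" for t z
  proof -
    have yV: "(t, z) \<in> V" and w0: "dx w0 Y (t, z) \<bullet> w0 > 0" using y by (auto simp: W_def)
    let ?x = "G (t, z)"
    have yd: "(t, ?x) \<in> dom" using GD[OF yV] Ddom by auto
    have sym: "dx v Y (t, z) \<bullet> w = v \<bullet> dx w Y (t, z)" for v w
      using dd_commute[OF V(1) HCk yV, of "(0, v)" "(0, w)"] by (simp add: ddH[OF yV] inner_commute)
    \<comment> \<open>By symmetry the squared norm of this vector is the inner product of
      \<open>z\<close> with another value of the same map, and all its values are orthogonal to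
      \<open>z\<close>.\<close>
    have Az: "dx z Y (t, z) = 0"
      using sym[of z "dx z Y (t, z)"] Yz[OF yV] by (simp add: inner_commute)
    obtain u where u: "u \<bullet> ?x = 0" "dx w0 Y (t, z) \<bullet> w0 = dx u Xh (t, ?x) \<bullet> dx u N (t, ?x)"
      using split[OF yV] by blast
    then have neg: "dx u (dx u Xh) (t, ?x) \<bullet> z < 0" using w0 weingarten[OF GD[OF yV]] NG[OF yV] by simp
    then have z: "z \<noteq> 0" by auto
    show "degenerate_form (\<lambda>w. dx w Y (t, z)) z"
      by (intro degenerate_form.intro dx_linear[OF YCk V(1) yV] sym Az z)
    have "u \<noteq> 0" using u(2) w0 linear_0[OF Xlin[OF GD[OF yV]]] by auto
    then have "dx u (dx u Xh) (t, ?x) \<bullet> nu t (proj ?x) < 0" by (rule dx_dx_neg[OF yd u(1)])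
    moreover obtain k where k: "nu t (proj ?x) = k *\<^sub>R z" using Npar[OF GD[OF yV]] NG[OF yV] z by auto
    ultimately have "k > 0" using neg by (simp add: mult_less_0_iff)
    moreover have "\<bar>k\<bar> * norm z = 1" using norm_nu[OF yd] k by simp
    ultimately have "k = 1 / norm z" using z by (simp add: field_simps)
    then show "nu t (proj ?x) = (1 / norm z) *\<^sub>R z" using k by simp
  qed

  define dsc where "dsc y = degenerate_form.disc (\<lambda>w. dx w Y y)" for y
  define trc where "trc y = degenerate_form.tr (\<lambda>w. dx w Y y)" for y
  have curv: "pinch t (proj (G (t, z))) = (norm z)\<^sup>2 * dsc (t, z) / 4" "speed t (proj (G (t, z))) = norm z * trc (t, z)"
    if y: "(t, z) \<in> W" for t z
  proof -
    have yV: "(t, z) \<in> V" using y by (auto simp: W_def)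
    let ?x = "G (t, z)" and ?A = "\<lambda>w. dx w Y (t, z)"
    let ?p = "proj ?x"
    have yd: "(t, ?x) \<in> dom" using GD[OF yV] Ddom by auto
    have x0: "?x \<noteq> 0" by (rule ne[OF GD[OF yV]])
    interpret degenerate_form ?A z by (rule deg[OF y])
    have nc: "normal_curv (X t) (nu t) ?p (proj u) = ?A w \<bullet> w / (norm z * (norm (?A w))\<^sup>2)"
      if u: "u \<bullet> ?x = 0" "u \<noteq> 0" and w: "?A w = dx u Xh (t, ?x)" "?A w \<bullet> w = dx u Xh (t, ?x) \<bullet> dx u N (t, ?x)" for u w
    proof -
      have "?A w \<bullet> w = - (dx u (dx u Xh) (t, ?x) \<bullet> z)"
        unfolding w(2) weingarten[OF GD[OF yV]] NG[OF yV] ..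
      then show ?thesis
        unfolding normal_curv_eq(2)[OF yd u] nuz[OF y] w(1)[symmetric] by simp
    qed
    have tang: "\<exists>u. u \<bullet> ?x = 0 \<and> u \<noteq> 0 \<and> ?A w = dx u Xh (t, ?x) \<and> ?A w \<bullet> w = dx u Xh (t, ?x) \<bullet> dx u N (t, ?x)"
      if w: "w \<bullet> z = 0" "w \<noteq> 0" for w
    proof -
      obtain u where u: "u \<bullet> ?x = 0" "?A w = dx u Xh (t, ?x)" "?A w \<bullet> w = dx u Xh (t, ?x) \<bullet> dx u N (t, ?x)"
        "u = 0 \<longrightarrow> (\<exists>r. w = r *\<^sub>R z)" using split[OF yV, of w] by blast
      have "u \<noteq> 0" using u(4) w z by auto
      then show ?thesis using u by blast
    qed
    let ?R = "{?A w \<bullet> w / (norm z * (norm (?A w))\<^sup>2) | w. w \<bullet> z = 0 \<and> w \<noteq> 0}"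
    \<comment> \<open>Tangent directions \<open>u\<close> correspond to normal variations
      \<open>dx u N\<close>. Removing from such a variation its component along \<open>z\<close>
      changes neither \<open>?A w\<close> nor \<open>?A w \<bullet> w\<close>, so the ratios may be
      restricted to the plane orthogonal to \<open>z\<close>.\<close>
    have R: "normal_curv (X t) (nu t) ?p ` unit_tangents ?p = ?R"
    proof (intro equalityI subsetI)
      fix r assume "r \<in> normal_curv (X t) (nu t) ?p ` unit_tangents ?p"
      then obtain u where u: "norm u = 1" "u \<bullet> ?p = 0" and r: "r = normal_curv (X t) (nu t) ?p u"
        by (auto simp: unit_tangents_def)
      have u': "u \<bullet> ?x = 0" "u \<noteq> 0" "proj u = u" using u x0 by (auto simp: proj_def)
      define w where "w = dx u N (t, ?x)"
      have w: "?A w = dx u Xh (t, ?x)" unfolding w_def by (rule dYN[OF yV])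
      define w' where "w' = w - ((w \<bullet> z) / (z \<bullet> z)) *\<^sub>R z"
      have w': "w' \<bullet> z = 0" using z by (simp add: w'_def inner_diff_left)
      have Aw': "?A w' = ?A w" unfolding w'_def by (simp add: linear_diff[OF A] linear_cmul[OF A] Az)
      have Aw'w': "?A w' \<bullet> w' = ?A w \<bullet> w"
        unfolding Aw' using Yz[OF yV, of w] by (simp add: w'_def inner_diff_right)
      have "w' \<noteq> 0" using Aw' w normal_curv_eq(4)[OF yd u'(1,2)] linear_0[OF A] by auto
      moreover have "r = ?A w' \<bullet> w' / (norm z * (norm (?A w'))\<^sup>2)"
        by (subst Aw'w', subst Aw', subst r, subst (1) u'(3)[symmetric], rule nc[OF u'(1,2) w])
           (unfold w, simp add: w_def)
      ultimately show "r \<in> ?R" using w' by blast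
    next
      fix r assume "r \<in> ?R"
      then obtain w where w: "w \<bullet> z = 0" "w \<noteq> 0" and r: "r = ?A w \<bullet> w / (norm z * (norm (?A w))\<^sup>2)" by blast
      obtain u where u: "u \<bullet> ?x = 0" "u \<noteq> 0" "?A w = dx u Xh (t, ?x)" "?A w \<bullet> w = dx u Xh (t, ?x) \<bullet> dx u N (t, ?x)"
        using tang[OF w] by blast
      have "r = normal_curv (X t) (nu t) ?p (proj u)" unfolding r by (rule nc[OF u, symmetric])
      then show "r \<in> normal_curv (X t) (nu t) ?p ` unit_tangents ?p"
        using normal_curv_eq(1)[OF yd u(1,2)] by blast
    qed
    have inj: "?A w \<noteq> 0" if "w \<bullet> z = 0" "w \<noteq> 0" for w
      using tang[OF that] normal_curv_eq(4)[OF yd] by metis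
    show "pinch t ?p = (norm z)\<^sup>2 * dsc (t, z) / 4"
      unfolding pinch_def lam1_def lam2_def R dsc_def by (rule ratio_bounds(3)[OF inj])
    show "speed t ?p = norm z * trc (t, z)"
      unfolding speed_def lam1_def lam2_def R trc_def by (rule ratio_bounds(2)[OF inj])
  qed

  have pde: "dd (1, 0) H (t, z) = (z \<bullet> z) * trc (t, z)" if y: "(t, z) \<in> W" for t z
  proof -
    have yV: "(t, z) \<in> V" using y by (auto simp: W_def)
    let ?x = "G (t, z)"
    have yd: "(t, ?x) \<in> dom" using GD[OF yV] Ddom by auto
    have z: "z \<noteq> 0" using deg[OF y] by (simp add: degenerate_form_def)
    obtain u where u: "dd (1, 0) g (t, z) = (1, u)" using fst_dg[OF yV, of "(1, 0)"] by (cases "dd (1, 0) g (t, z)") auto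
    have bl: "linear (\<lambda>v. dd v Xh (t, ?x))"
      by (rule bounded_linear.linear[OF dd_linear[OF oD XCk GD[OF yV]]])
    have "dd (1, 0) H (t, z) = dd (1, 0) Y (t, z) \<bullet> z" by (simp add: dH[OF yV])
    \<comment> \<open>With the normal held fixed the parameter point slides by \<open>u\<close>.
      This sliding moves the surface point tangentially and is invisible to \<open>z\<close>, so
      only the normal speed remains.\<close>
    also have "dd (1, 0) Y (t, z) = dd (1, u) Xh (t, ?x)" unfolding dY[OF yV] u gG[OF yV] ..
    also have "(1 :: real, u) = (1, 0) + (0, u)" by simp
    also have "dd ((1, 0) + (0, u)) Xh (t, ?x) = dd (1, 0) Xh (t, ?x) + dx u Xh (t, ?x)" by (rule linear_add[OF bl])
    also have "\<dots> \<bullet> z = dd (1, 0) Xh (t, ?x) \<bullet> z"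
      using Northo[OF GD[OF yV], of u] NG[OF yV] by (simp add: inner_add_left)
    also have "\<dots> = (norm z * trc (t, z)) *\<^sub>R ((1 / norm z) *\<^sub>R z) \<bullet> z"
      unfolding time_derivative[OF yd, folded speed_def] curv(2)[OF y] nuz[OF y] ..
    also have "\<dots> = (z \<bullet> z) * trc (t, z)" using z by simp
    finally show ?thesis .
  qed

  show thesis
  proof (rule that[of z0 W H Y])
    show nz0: "norm z0 = 1" using norm_nu[OF y0] pj by (simp add: z0_def)
    show "pinch t0 p0 = degenerate_form.disc (\<lambda>w. dx w Y (t0, z0)) / 4"
      using curv(1)[OF z0W] G0 pj nz0 by (simp add: dsc_def)
    show "open W" "(t0, z0) \<in> W" by (rule oW, rule z0W)
    show "Ck k W H" for k by (rule Ck_subset[OF HCk WV])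
    show "dx v (dx w H) (t, z) = dx v Y (t, z) \<bullet> w" if "(t, z) \<in> W" for t z v w
      using ddH that WV by blast
    show "dd (1, 0) H (t, z) = (z \<bullet> z) * degenerate_form.tr (\<lambda>w. dx w Y (t, z))" if "(t, z) \<in> W" for t z
      using pde[OF that] by (simp add: trc_def)
    show "\<exists>p\<in>S2. t \<in> {a<..<b} \<and> pinch t p = (norm z)\<^sup>2 * degenerate_form.disc (\<lambda>w. dx w Y (t, z)) / 4"
      if y: "(t, z) \<in> W" for t z
    proof -
      have "(t, G (t, z)) \<in> dom" using GD y WV Ddom by blast
      then show ?thesis using curv(1)[OF y] proj_S2 by (intro bexI[of _ "proj (G (t, z))"]) (auto simp: dom_def dsc_def)
    qed
    \<comment> \<open>\<open>pinch\<close> in normal coordinates: continuous because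
      \<open>disc\<close> is a polynomial in derivatives of \<open>Y\<close>, and pulled back along
      \<open>\<Phi>\<close> to give continuity of \<open>pinch\<close> itself.\<close>
    define h where "h y = (norm (snd y))\<^sup>2 * dsc y / 4" for y
    have dYc: "continuous_on W (dd v Y)" for v
      by (rule continuous_on_subset[OF Ck_continuous[OF Ck_dd[OF YCk]] WV])
    have "continuous_on W h"
      unfolding h_def dsc_def
    proof (rule continuous_on_eq)
      show "continuous_on W (\<lambda>y. (norm (snd y))\<^sup>2 * (2 * (\<Sum>b\<in>Basis. dx b Y y \<bullet> dx b Y y) - (\<Sum>b\<in>Basis. dx b Y y \<bullet> b)\<^sup>2) / 4)"
        by (intro continuous_intros dYc) simp
      fix y assume "y \<in> W"
      then interpret degenerate_form "\<lambda>w. dx w Y y" "snd y" using deg[of "fst y" "snd y"] by simp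
      show "(norm (snd y))\<^sup>2 * (2 * (\<Sum>b\<in>Basis. dx b Y y \<bullet> dx b Y y) - (\<Sum>b\<in>Basis. dx b Y y \<bullet> b)\<^sup>2) / 4 = (norm (snd y))\<^sup>2 * disc / 4"
        by (simp add: disc_def tr_def)
    qed
    then have "isCont h (\<Phi> (t0, p0))" using oW z0W P0 by (simp add: continuous_on_eq_continuous_at)
    moreover have Pc: "continuous_on T \<Phi>" by (rule continuous_on_subset[OF Ck_continuous[OF PCk] T(2)])
    then have "isCont \<Phi> (t0, p0)" using T by (simp add: continuous_on_eq_continuous_at)
    ultimately have "isCont (\<lambda>y. h (\<Phi> y)) (t0, p0)" by (rule isCont_o2[rotated])
    then have lim: "((\<lambda>y. h (\<Phi> y)) \<longlongrightarrow> h (\<Phi> (t0, p0))) (at (t0, p0) within {a<..<b} \<times> S2)"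
      unfolding isCont_def by (rule tendsto_within_subset) simp
    have hP: "h (\<Phi> y) = pinch (fst y) (snd y)" if y: "y \<in> T \<inter> \<Phi> -` W" "snd y \<in> S2" for y
    proof -
      obtain t p where tp: "y = (t, p)" by (cases y)
      have W: "(t, N (t, p)) \<in> W" using y tp by (simp add: \<Phi>_def)
      have "G (t, N (t, p)) = p" using gP[of y] y tp by (simp add: G_def \<Phi>_def)
      then show ?thesis using curv(1)[OF W] proj_id[of p] y(2) tp by (simp add: h_def \<Phi>_def)
    qed
    have oO: "open (T \<inter> \<Phi> -` W)" by (rule continuous_open_preimage[OF Pc T(1) oW])
    have y0O: "(t0, p0) \<in> T \<inter> \<Phi> -` W" using T(3) P0 z0W by simp
    have "\<forall>\<^sub>F y in at (t0, p0) within {a<..<b} \<times> S2. h (\<Phi> y) = pinch (fst y) (snd y)"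
      unfolding eventually_at_topological
      using oO y0O hP by (intro exI[of _ "T \<inter> \<Phi> -` W"] conjI ballI impI) (blast, blast, fastforce)
    with lim have "((\<lambda>y. pinch (fst y) (snd y)) \<longlongrightarrow> h (\<Phi> (t0, p0))) (at (t0, p0) within {a<..<b} \<times> S2)"
      by (rule Lim_transform_eventually)
    then show "continuous (at (t0, p0) within {a<..<b} \<times> S2) (\<lambda>y. pinch (fst y) (snd y))"
      unfolding continuous_within using hP[OF y0O] p0 by simp
  qed (rule deg)
qed

text \<open>If the supremum increased, the maximum over the compact slab between \<open>t1\<close>
  and \<open>t2\<close> would exceed every value at time \<open>t1\<close>. It would thus be
  positive and attained after \<open>t1\<close>, and the support function near that point would
  violate \<open>max_principle_heat\<close>.\<close>

lemma sup_pinch_nonincreasing: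
  assumes t1: "t1 \<in> {a<..<b}" and t2: "t2 \<in> {a<..<b}" and le: "t1 \<le> t2"
  shows "(SUP p\<in>S2. pinch t2 p) \<le> (SUP p\<in>S2. pinch t1 p)"
proof (rule ccontr)
  assume less: "\<not> ?thesis"
  have ne: "S2 \<noteq> {}" by simp
  have dom: "(t, p) \<in> dom" if "t \<in> {a<..<b}" "p \<in> S2" for t p using that by (auto simp: dom_def)
  have cont: "continuous_on ({a<..<b} \<times> S2) (\<lambda>y. pinch (fst y) (snd y))"
    unfolding continuous_on_eq_continuous_within
  proof
    fix y assume "y \<in> {a<..<b} \<times> S2"
    then obtain t p where y: "y = (t, p)" and tp: "t \<in> {a<..<b}" "p \<in> S2" by auto
    show "continuous (at y within {a<..<b} \<times> S2) (\<lambda>y. pinch (fst y) (snd y))"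
      unfolding y by (rule local_representation[OF dom[OF tp] tp(2)])
  qed
  have sub: "{t1..t2} \<times> S2 \<subseteq> {a<..<b} \<times> S2" using t1 t2 by auto
  have "compact ({t1..t2} \<times> S2)" by (intro compact_Times compact_Icc compact_sphere)
  moreover have "{t1..t2} \<times> S2 \<noteq> {}" using le ne by auto
  ultimately obtain y where "y \<in> {t1..t2} \<times> S2" "\<forall>y'\<in>{t1..t2} \<times> S2. pinch (fst y') (snd y') \<le> pinch (fst y) (snd y)"
    using continuous_attains_sup[OF _ _ continuous_on_subset[OF cont sub]] by blast
  then obtain t0 p0 where t0: "t0 \<in> {t1..t2}" and p0: "p0 \<in> S2"
    and max: "\<And>t p. t \<in> {t1..t2} \<Longrightarrow> p \<in> S2 \<Longrightarrow> pinch t p \<le> pinch t0 p0" by fastforce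
  have sup: "pinch t1 p \<le> (SUP p\<in>S2. pinch t1 p)" if "p \<in> S2" for p
    by (rule cSUP_upper[OF that]) (use max[of t1] le in \<open>auto intro!: bdd_aboveI2[of _ _ "pinch t0 p0"]\<close>)
  have "(SUP p\<in>S2. pinch t2 p) \<le> pinch t0 p0"
    by (rule cSUP_least[OF ne]) (use max le in auto)
  with less have big: "pinch t0 p0 > (SUP p\<in>S2. pinch t1 p)" by linarith
  then have t01: "t1 < t0" using sup[OF p0] t0 by (cases "t0 = t1") auto
  have "0 \<le> pinch t1 p0" by (simp add: pinch_def)
  then have pos: "pinch t0 p0 > 0" using sup[OF p0] big by linarith

  have "t0 \<in> {a<..<b}" using t0 t1 t2 by auto
  obtain z0 :: "real^3" and W and H :: "real \<times> (real^3) \<Rightarrow> real" and Y :: "real \<times> (real^3) \<Rightarrow> real^3"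
    where z0: "norm z0 = 1" and W: "open W" "(t0, z0) \<in> W" and H: "\<And>k. Ck k W H"
    and deg: "\<And>t z. (t, z) \<in> W \<Longrightarrow> degenerate_form (\<lambda>w. dx w Y (t, z)) z"
    and ddH: "\<And>t z v w. (t, z) \<in> W \<Longrightarrow> dx v (dx w H) (t, z) = dx v Y (t, z) \<bullet> w"
    and pde: "\<And>t z. (t, z) \<in> W \<Longrightarrow> dd (1, 0) H (t, z) = (z \<bullet> z) * degenerate_form.tr (\<lambda>w. dx w Y (t, z))"
    and pinch: "\<And>t z. (t, z) \<in> W \<Longrightarrow> \<exists>p\<in>S2. t \<in> {a<..<b} \<and> pinch t p = (norm z)\<^sup>2 * degenerate_form.disc (\<lambda>w. dx w Y (t, z)) / 4"
    and pinch0: "pinch t0 p0 = degenerate_form.disc (\<lambda>w. dx w Y (t0, z0)) / 4"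
    by (rule local_representation[OF dom[OF \<open>t0 \<in> {a<..<b}\<close> p0] p0]) (rule that; assumption)
  interpret A0: degenerate_form "\<lambda>w. dx w Y (t0, z0)" z0 by (rule deg[OF W(2)])
  obtain e1 e2 where e: "A0.ortho_pair e1 e2" "dx e1 Y (t0, z0) \<bullet> e2 = 0"
    "dx e2 Y (t0, z0) \<bullet> e2 \<le> dx e1 Y (t0, z0) \<bullet> e1" using A0.diagonalize by blast
  \<comment> \<open>The gap between the two principal radii at the maximum point, where
    \<open>z0\<close> has length 1; hence \<open>q\<^sup>2 = 4 * pinch t0 p0\<close>.\<close>
  define q where "q = dx e1 (dx e1 H) (t0, z0) - dx e2 (dx e2 H) (t0, z0)"
  have q: "q\<^sup>2 = 4 * pinch t0 p0" "q \<ge> 0"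
    using A0.tr_ortho_pair(2)[OF e(1)] e(2,3) pinch0 by (simp_all add: q_def ddH[OF W(2)])
  have on: "norm e1 = 1" "norm e2 = 1" "norm z0 = 1" "e1 \<bullet> e2 = 0" "e1 \<bullet> z0 = 0" "e2 \<bullet> z0 = 0"
    using e(1) z0 by (auto simp: A0.ortho_pair_def)
  show False
  proof (rule max_principle_heat[OF W(1) H _ _ on W(2) t01])
    fix t z assume y: "(t, z) \<in> W"
    interpret degenerate_form "\<lambda>w. dx w Y (t, z)" z by (rule deg[OF y])
    show "dx z (dx w H) (t, z) = 0" for w using Az by (simp add: ddH[OF y])
    show "dd (1, 0) H (t, z) = (z \<bullet> z) * (dx e1 (dx e1 H) (t, z) + dx e2 (dx e2 H) (t, z) + dx z0 (dx z0 H) (t, z))"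
      unfolding pde[OF y] ddH[OF y] tr_def trace_orthonormal[OF on A] ..
    fix u v assume t: "t1 \<le> t" "t \<le> t0" and uv: "norm u = 1" "norm v = 1" "u \<bullet> v = 0" "u \<bullet> z = 0" "v \<bullet> z = 0"
    \<comment> \<open>Maximality speaks about surface points, so the point with normal along
      \<open>z\<close> is used; for a frame that is not principal, the off-diagonal term in
      \<open>disc\<close> only strengthens the inequality.\<close>
    obtain p where p: "p \<in> S2" "pinch t p = (norm z)\<^sup>2 * disc / 4" using pinch[OF y] by blast
    have op: "ortho_pair u v" using uv by (simp add: ortho_pair_def)
    have "(norm z * (dx u (dx u H) (t, z) - dx v (dx v H) (t, z)))\<^sup>2 \<le> (norm z)\<^sup>2 * disc"
      unfolding tr_ortho_pair(2)[OF op] ddH[OF y] by (simp add: power_mult_distrib mult_left_mono)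
    also have "\<dots> = 4 * pinch t p" using p by simp
    also have "\<dots> \<le> q\<^sup>2" using max[of t p] p(1) t t0 q by simp
    finally show "norm z * (dx u (dx u H) (t, z) - dx v (dx v H) (t, z))
        \<le> dx e1 (dx e1 H) (t0, z0) - dx e2 (dx e2 H) (t0, z0)"
      using q(2) unfolding q_def by (rule power2_le_imp_le)
  next
    show "0 < dx e1 (dx e1 H) (t0, z0) - dx e2 (dx e2 H) (t0, z0)"
      using q pos unfolding q_def[symmetric] by (metis mult_pos_pos not_less_iff_gr_or_eq order_le_less zero_eq_power2 zero_less_numeral)
  qed
qed

end

text \<open>Continuity of \<open>pinch\<close>, part of \<open>local_representation\<close>, and
  compactness of \<open>S2\<close> ensure that both suprema are attained, so they are the maxima of
  the informal statement.\<close>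

theorem theorem10p9:
  fixes X :: "real \<Rightarrow> real^3 \<Rightarrow> real^3"
    and nu :: "real \<Rightarrow> real^3 \<Rightarrow> real^3"
    and a b :: real and U :: "(real^3) set"
  assumes "a < b"
    and "S2 \<subseteq> U"
    and smooth: "smooth_on ({a<..<b} \<times> U) (\<lambda>(t, x). X t x)"
    and embedded: "\<forall>t\<in>{a<..<b}. embedded_sphere (X t)"
    and normal: "\<forall>t\<in>{a<..<b}. outer_unit_normal (X t) (nu t)"
    and strictly_convex: "\<forall>t\<in>{a<..<b}. \<forall>p\<in>S2. lam1 (X t) (nu t) p > 0 \<and> lam2 (X t) (nu t) p > 0"
    and flow: "\<forall>t\<in>{a<..<b}. \<forall>p\<in>S2.
       ((\<lambda>s. X s p) has_vector_derivative
          ((lam1 (X t) (nu t) p + lam2 (X t) (nu t) p)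
             / (lam1 (X t) (nu t) p * lam2 (X t) (nu t) p)) *\<^sub>R nu t p) (at t)"
  shows "\<forall>t1\<in>{a<..<b}. \<forall>t2\<in>{a<..<b}. t1 \<le> t2 \<longrightarrow>
     (SUP p\<in>S2. (lam1 (X t2) (nu t2) p - lam2 (X t2) (nu t2) p)\<^sup>2
                 / (4 * (lam1 (X t2) (nu t2) p)\<^sup>2 * (lam2 (X t2) (nu t2) p)\<^sup>2))
     \<le> (SUP p\<in>S2. (lam1 (X t1) (nu t1) p - lam2 (X t1) (nu t1) p)\<^sup>2
                 / (4 * (lam1 (X t1) (nu t1) p)\<^sup>2 * (lam2 (X t1) (nu t1) p)\<^sup>2))"
proof -
  interpret convex_flow X nu a b U
    by unfold_locales (use assms in blast)+
  show ?thesis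
    using sup_pinch_nonincreasing unfolding pinch_def by blast
qed

end
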